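(* Let $\mathcal{V}:[0,1]\to\mathcal{D}$ be a vineyard (admitting a decomposition into finitely many vines as described in the context), and let $w$ be a weighting function. Then the $w$-weighted vineyard distance of $\mathcal{V}$, computed from any decomposition of $\mathcal{V}$ into vines, satisfies $$\mathbb{V}^{(w)}(\mathcal{V})=\lim_{n\to\infty}\sum_{i=1}^{n}W^{(w)}_{\infty,1}\left(\mathcal{V}\left(\tfrac{i}{n}\right),\mathcal{V}\left(\tfrac{i-1}{n}\right)\right).$$
   Context: Let $\mathbb{R}^2_{x\le y}=\{(x,y)\in\mathbb{R}^2 : x\le y\}$ and let $\Delta=\{(x,x)\}$ be the diagonal. A persistence diagram is a finite multiset of points of $\mathbb{R}^2_{x\le y}$ (points on $\Delta$ are allowed); $\mathcal{D}$ is the set of all persistence diagrams. A partial bijection from a multiset $P$ to a multiset $Q$ is a bijection $\pi:A\to B$ between sub-multisets $A\subseteq P$, $B\subseteq Q$. Write $d_\infty$ for the sup-norm metric on $\mathbb{R}^2$ and $d_\infty(\alpha,\Delta)$ for the distance from $\alpha$ to $\Delta$. The bottleneck distance is $$W_\infty(P,Q)=\min_{\pi:A\to B}\max\Big(\max_{\alpha\in A}d_\infty(\alpha,\pi(\alpha)),\max_{\alpha\in P\setminus A}d_\infty(\alpha,\Delta),\max_{\beta\in Q\setminus B}d_\infty(\beta,\Delta)\Big),$$ the minimum being over partial bijections from $P$ to $Q$. $\mathcal{D}$ carries the topology arising from $W_\infty$. A vineyard is a continuous map $\mathcal{V}:[0,1]\to\mathcal{D}$. Standing assumption: every vineyard can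 be decomposed into finitely many rectifiable (continuous) curves $V_i:[0,1]\to\mathbb{R}^2$, $1\le i\le m$, called vines, such that for every $t$, $\mathcal{V}(t)$ is the multiset $\{V_i(t):1\le i\le m\}$, and each vine $V$ in the decomposition is of one of four types: (1) $V$ never meets $\Delta$; (2) $\mathrm{Im}(V)\cap\Delta=\{x\}$ and $V^{-1}(x)$ is a closed interval containing $1$; (3) $\mathrm{Im}(V)\cap\Delta=\{x\}$ and $V^{-1}(x)$ is a closed interval containing $0$; (4) $\mathrm{Im}(V)\cap\Delta=\{x,y\}$ and $V^{-1}(x)\cup V^{-1}(y)$ is a union of two closed intervals which contains $0$ and $1$. "Decomposition into vines" always means one of this kind. A weighting function is a uniformly continuous function $w:\mathbb{R}^2_{x\le y}\to\mathbb{R}_{\ge0}$ that is non-zero outside of the diagonal. Given a decomposition of $\mathcal{V}$ into vines $V_1,\dots,V_m$, the $w$-weighted vineyard distance is $\mathbb{V}^{(w)}(\mathcal{V})=\sum_{i=1}^m\int_{V_i}w\,ds$, where the line integrals are computed with arc length $ds$ measured in the $\ell^\infty$ metric on the plane. The $w$-weighted $(\infty,1)$-Wasserstein distance is $$W^{(w)}_{\infty,1}(P,Q)=\min_{\pi:A\to B}\Big(\sum_{\alpha\in A}d^{(w)}_\infty(\alpha,\pi(\alpha))+\sum_{\alpha\in P\setminus A}d^{(w)}_\infty(\alpha,\Delta)+\sum_{\beta\in Q\setminus B}d^{(w)}_\infty(\beta,\Delta)\Big),$$ over partial bijections from $P$ to $Q$, where $d^{(w)}_\infty(p_0,p_1)=d_\infty(p_0,p_1)\,\frac{w(p_0)+w(p_1)}{2}$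 and $d^{(w)}_\infty(\alpha,\Delta)=\inf_{\delta\in\Delta}d^{(w)}_\infty(\alpha,\delta)$. *)

theory Defs
  imports "HOL-Analysis.Analysis"
begin

section \<open>Persistence diagrams and partial bijections\<close>

type_synonym point = "real \<times> real"
type_synonym diagram = "point multiset"

definition half_plane :: "point set" where
  "half_plane = {(x, y). x \<le> y}"

definition diagonal :: "point set" where
  "diagonal = {(x, y). x = y}"

definition diagrams :: "diagram set" where
  "diagrams = {P. set_mset P \<subseteq> half_plane}"

text \<open>A bijection between sub-multisets \<open>A \<subseteq># P\<close> and \<open>B \<subseteq># Q\<close> is given by the multiset \<open>M\<close> of its
  matched pairs: \<open>A\<close> and \<open>B\<close> are the two marginals of \<open>M\<close>.\<close>

definition partial_bijection :: "'a multiset \<Rightarrow> 'b multiset \<Rightarrow> ('a \<times> 'b) multiset \<Rightarrow> bool" where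
  "partial_bijection P Q M \<longleftrightarrow> image_mset fst M \<subseteq># P \<and> image_mset snd M \<subseteq># Q"

lemma finite_partial_bijections: "finite {M. partial_bijection P Q M}"
proof -
  let ?L = "{xs. set xs \<subseteq> set_mset P \<times> set_mset Q \<and> length xs \<le> size P}"
  have "{M. partial_bijection P Q M} \<subseteq> mset ` ?L"
  proof
    fix M assume "M \<in> {M. partial_bijection P Q M}"
    then have *: "image_mset fst M \<subseteq># P" "image_mset snd M \<subseteq># Q"
      by (auto simp: partial_bijection_def)
    obtain xs where xs: "M = mset xs"
      by (metis ex_mset)
    have "fst ` set xs \<subseteq> set_mset P" "snd ` set xs \<subseteq> set_mset Q"
      using set_mset_mono[OF *(1)] set_mset_mono[OF *(2)] by (auto simp: xs)
    then have "set xs \<subseteq> set_mset P \<times> set_mset Q"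
      by force
    moreover have "length xs \<le> size P"
      using size_mset_mono[OF *(1)] by (simp add: xs)
    ultimately show "M \<in> mset ` ?L"
      using xs by blast
  qed
  moreover have "finite ?L"
    by (intro finite_lists_length_le) simp
  ultimately show ?thesis
    by (meson finite_imageI finite_subset)
qed

lemma partial_bijection_empty [simp]: "partial_bijection P Q {#}"
  by (simp add: partial_bijection_def)


section \<open>Bottleneck distance and vineyards\<close>

definition d_inf :: "point \<Rightarrow> point \<Rightarrow> real" where
  "d_inf p q = infnorm (p - q)"

lemma d_inf_eq_max: "d_inf p q = max \<bar>fst p - fst q\<bar> \<bar>snd p - snd q\<bar>"
proof -
  have "{\<bar>(p - q) \<bullet> b\<bar> |b. b \<in> Basis} = (\<lambda>b. \<bar>(p - q) \<bullet> b\<bar>) ` {(1, 0), (0, 1)}"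
    unfolding Basis_prod_def by (auto simp: image_iff)
  also have "\<dots> = {\<bar>fst p - fst q\<bar>, \<bar>snd p - snd q\<bar>}"
    by (simp add: inner_prod_def)
  finally show ?thesis
    by (simp add: d_inf_def infnorm_def cSup_eq_Max)
qed

definition d_inf_diag :: "point \<Rightarrow> real" where
  "d_inf_diag \<alpha> = (INF \<delta>\<in>diagonal. d_inf \<alpha> \<delta>)"

text \<open>The \<open>insert 0\<close> makes the maximum over an empty collection equal to \<open>0\<close>.\<close>

definition bottleneck_cost :: "diagram \<Rightarrow> diagram \<Rightarrow> (point \<times> point) multiset \<Rightarrow> real" where
  "bottleneck_cost P Q M = Max (insert 0 (
     (\<lambda>(\<alpha>, \<beta>). d_inf \<alpha> \<beta>) ` set_mset M
     \<union> d_inf_diag ` set_mset (P - image_mset fst M)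
     \<union> d_inf_diag ` set_mset (Q - image_mset snd M)))"

definition bottleneck :: "diagram \<Rightarrow> diagram \<Rightarrow> real" where
  "bottleneck P Q = Min (bottleneck_cost P Q ` {M. partial_bijection P Q M})"

text \<open>The bottleneck distance is only a pseudometric, since points on the diagonal can be
  discarded at no cost. So \<open>Metric_space.mtopology\<close> does not apply, and the topology is
  given by its open sets.\<close>

definition diagram_topology :: "diagram topology" where
  "diagram_topology = topology (\<lambda>U. U \<subseteq> diagrams \<and>
     (\<forall>P\<in>U. \<exists>\<epsilon>>0. \<forall>Q\<in>diagrams. bottleneck P Q < \<epsilon> \<longrightarrow> Q \<in> U))"

lemma openin_diagram_topology:
  "openin diagram_topology U \<longleftrightarrow> U \<subseteq> diagrams \<and>
     (\<forall>P\<in>U. \<exists>\<epsilon>>0. \<forall>Q\<in>diagrams. bottleneck P Q < \<epsilon> \<longrightarrow> Q \<in> U)"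
proof -
  let ?O = "\<lambda>U. U \<subseteq> diagrams \<and>
     (\<forall>P\<in>U. \<exists>\<epsilon>>0. \<forall>Q\<in>diagrams. bottleneck P Q < \<epsilon> \<longrightarrow> Q \<in> U)"
  have "istopology ?O"
    unfolding istopology_def
  proof (intro conjI allI impI)
    fix S T assume S: "?O S" and T: "?O T"
    then show "S \<inter> T \<subseteq> diagrams" by blast
    show "\<forall>P\<in>S \<inter> T. \<exists>\<epsilon>>0. \<forall>Q\<in>diagrams. bottleneck P Q < \<epsilon> \<longrightarrow> Q \<in> S \<inter> T"
    proof
      fix P assume P: "P \<in> S \<inter> T"
      obtain e where e: "e > 0" "\<forall>Q\<in>diagrams. bottleneck P Q < e \<longrightarrow> Q \<in> S"
        using S P by blast
      obtain e' where e': "e' > 0" "\<forall>Q\<in>diagrams. bottleneck P Q < e' \<longrightarrow> Q \<in> T"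
        using T P by blast
      show "\<exists>\<epsilon>>0. \<forall>Q\<in>diagrams. bottleneck P Q < \<epsilon> \<longrightarrow> Q \<in> S \<inter> T"
        using e e' by (intro exI[of _ "min e e'"]) auto
    qed
  next
    fix K assume "\<forall>S\<in>K. ?O S"
    then show "\<Union>K \<subseteq> diagrams" by blast
  next
    fix K assume K: "\<forall>S\<in>K. ?O S"
    show "\<forall>P\<in>\<Union>K. \<exists>\<epsilon>>0. \<forall>Q\<in>diagrams. bottleneck P Q < \<epsilon> \<longrightarrow> Q \<in> \<Union>K"
    proof
      fix P assume "P \<in> \<Union>K"
      then obtain S where S: "S \<in> K" "P \<in> S" by blast
      then obtain e where "e > 0" "\<forall>Q\<in>diagrams. bottleneck P Q < e \<longrightarrow> Q \<in> S"
        using K by blast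
      then show "\<exists>\<epsilon>>0. \<forall>Q\<in>diagrams. bottleneck P Q < \<epsilon> \<longrightarrow> Q \<in> \<Union>K"
        using S by blast
    qed
  qed
  then show ?thesis
    by (simp add: diagram_topology_def topology_inverse')
qed

lemma topspace_diagram_topology [simp]: "topspace diagram_topology = diagrams"
proof
  show "topspace diagram_topology \<subseteq> diagrams"
    by (auto simp: topspace_def openin_diagram_topology)
  have "openin diagram_topology diagrams"
    unfolding openin_diagram_topology using zero_less_one by blast
  then show "diagrams \<subseteq> topspace diagram_topology"
    by (rule openin_subset)
qed

definition vineyard :: "(real \<Rightarrow> diagram) \<Rightarrow> bool" where
  "vineyard \<V> \<longleftrightarrow> continuous_map (top_of_set {0..1}) diagram_topology \<V>"


section \<open>Rectifiable curves and line integrals\<close>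

text \<open>Lengths, in the sup norm, of the polygons inscribed in \<open>v\<close> on \<open>[a, b]\<close>.\<close>

definition polygon_lengths :: "(real \<Rightarrow> point) \<Rightarrow> real \<Rightarrow> real \<Rightarrow> real set" where
  "polygon_lengths v a b = {\<Sum>k<n. d_inf (v (t k)) (v (t (Suc k))) | (n :: nat) t.
     mono_on {..n} t \<and> t 0 = a \<and> t n = b}"

definition rectifiable :: "(real \<Rightarrow> point) \<Rightarrow> bool" where
  "rectifiable v \<longleftrightarrow> bdd_above (polygon_lengths v 0 1)"

definition arc_length :: "(real \<Rightarrow> point) \<Rightarrow> real \<Rightarrow> real" where
  "arc_length v t = Sup (polygon_lengths v 0 t)"

text \<open>The point reached after travelling arc length \<open>s\<close> along \<open>v\<close>. It does not depend on the
  parameter chosen, see \<open>arc_length_param_arc_length\<close> below.\<close>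

definition arc_length_param :: "(real \<Rightarrow> point) \<Rightarrow> real \<Rightarrow> point" where
  "arc_length_param v s = v (SOME t. t \<in> {0..1} \<and> arc_length v t = s)"

definition line_integral :: "(point \<Rightarrow> real) \<Rightarrow> (real \<Rightarrow> point) \<Rightarrow> real" where
  "line_integral w v = integral {0..arc_length v 1} (\<lambda>s. w (arc_length_param v s))"

lemma d_inf_nonneg: "0 \<le> d_inf p q"
  by (simp add: d_inf_def infnorm_pos_le)

lemma polygon_lengths_extend:
  assumes "l \<in> polygon_lengths v a b" "b \<le> c"
  shows "l + d_inf (v b) (v c) \<in> polygon_lengths v a c"
proof -
  obtain n t where l: "l = (\<Sum>k<n. d_inf (v (t k)) (v (t (Suc k))))"
    and t: "mono_on {..n} t" "t 0 = a" "t n = b"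
    using assms(1) by (auto simp: polygon_lengths_def)
  define t' where "t' = t(Suc n := c)"
  have "mono_on {..Suc n} t'"
  proof (rule mono_onI)
    fix r s assume rs: "r \<in> {..Suc n}" "s \<in> {..Suc n}" "r \<le> s"
    have *: "t i \<le> t j" if "i \<le> j" "j \<le> n" for i j
      using mono_onD[OF t(1)] that by simp
    show "t' r \<le> t' s"
    proof (cases "s = Suc n")
      case True
      then show ?thesis
        using *[of r n] rs t(3) assms(2) by (cases "r = Suc n") (auto simp: t'_def)
    next
      case False
      then show ?thesis
        using *[of r s] rs by (auto simp: t'_def)
    qed
  qed
  moreover have "l + d_inf (v b) (v c) = (\<Sum>k<Suc n. d_inf (v (t' k)) (v (t' (Suc k))))"
    by (simp add: l t'_def t(3))
  ultimately show ?thesis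
    using t(2) unfolding polygon_lengths_def
    by (intro CollectI exI[of _ "Suc n"] exI[of _ t']) (auto simp: t'_def)
qed

lemma arc_length_extend:
  assumes "rectifiable v" "0 \<le> s" "s \<le> t" "t \<le> 1"
  shows "arc_length v s + d_inf (v s) (v t) \<le> arc_length v t"
proof -
  have bdd: "bdd_above (polygon_lengths v 0 t)"
  proof -
    obtain B where B: "\<And>l. l \<in> polygon_lengths v 0 1 \<Longrightarrow> l \<le> B"
      using assms(1) by (auto simp: rectifiable_def bdd_above_def)
    have "l \<le> B" if "l \<in> polygon_lengths v 0 t" for l
      using B[OF polygon_lengths_extend[OF that assms(4)]] d_inf_nonneg[of "v t" "v 1"] by linarith
    then show ?thesis
      by (auto simp: bdd_above_def)
  qed
  have "0 + d_inf (v 0) (v s) \<in> polygon_lengths v 0 s"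
    by (rule polygon_lengths_extend[OF _ assms(2)])
      (auto simp: polygon_lengths_def intro!: exI[of _ "0::nat"] exI[of _ "\<lambda>_. 0"] mono_onI)
  then have "polygon_lengths v 0 s \<noteq> {}"
    by blast
  then have "arc_length v s \<le> arc_length v t - d_inf (v s) (v t)"
    unfolding arc_length_def
  proof (rule cSup_least)
    fix l assume "l \<in> polygon_lengths v 0 s"
    then show "l \<le> Sup (polygon_lengths v 0 t) - d_inf (v s) (v t)"
      using cSup_upper[OF polygon_lengths_extend[OF _ assms(3)] bdd] by force
  qed
  then show ?thesis by simp
qed

lemma arc_length_param_arc_length:
  assumes "rectifiable v" "t \<in> {0..1}"
  shows "arc_length_param v (arc_length v t) = v t"
proof -
  define u where "u = (SOME u. u \<in> {0..1} \<and> arc_length v u = arc_length v t)"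
  have u: "u \<in> {0..1} \<and> arc_length v u = arc_length v t"
    unfolding u_def by (rule someI[of _ t]) (use assms in auto)
  have "v u = v t"
  proof (cases "u \<le> t")
    case True
    then have "d_inf (v u) (v t) \<le> 0"
      using arc_length_extend[OF assms(1), of u t] u assms(2) by simp
    then show ?thesis
      by (simp add: d_inf_def infnorm_pos_lt flip: not_less)
  next
    case False
    then have "d_inf (v t) (v u) \<le> 0"
      using arc_length_extend[OF assms(1), of t u] u assms(2) by simp
    then show ?thesis
      by (simp add: d_inf_def infnorm_pos_lt flip: not_less)
  qed
  then show ?thesis
    by (simp add: arc_length_param_def u_def)
qed


section \<open>Vines\<close>

definition vine_type1 :: "(real \<Rightarrow> point) \<Rightarrow> bool" where
  "vine_type1 v \<longleftrightarrow> v ` {0..1} \<inter> diagonal = {}"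

definition vine_type2 :: "(real \<Rightarrow> point) \<Rightarrow> bool" where
  "vine_type2 v \<longleftrightarrow> (\<exists>x. v ` {0..1} \<inter> diagonal = {x} \<and>
     (\<exists>a b. {t \<in> {0..1}. v t = x} = {a..b} \<and> 1 \<in> {a..b}))"

definition vine_type3 :: "(real \<Rightarrow> point) \<Rightarrow> bool" where
  "vine_type3 v \<longleftrightarrow> (\<exists>x. v ` {0..1} \<inter> diagonal = {x} \<and>
     (\<exists>a b. {t \<in> {0..1}. v t = x} = {a..b} \<and> 0 \<in> {a..b}))"

text \<open>The points \<open>x\<close> and \<open>y\<close> may coincide: a vine may return to the diagonal where it left it.\<close>

definition vine_type4 :: "(real \<Rightarrow> point) \<Rightarrow> bool" where
  "vine_type4 v \<longleftrightarrow> (\<exists>x y. v ` {0..1} \<inter> diagonal = {x, y} \<and>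
     (\<exists>a b c d. a \<le> b \<and> c \<le> d \<and>
        {t \<in> {0..1}. v t = x} \<union> {t \<in> {0..1}. v t = y} = {a..b} \<union> {c..d} \<and>
        0 \<in> {a..b} \<union> {c..d} \<and> 1 \<in> {a..b} \<union> {c..d}))"

definition vine :: "(real \<Rightarrow> point) \<Rightarrow> bool" where
  "vine v \<longleftrightarrow> continuous_on {0..1} v \<and> rectifiable v \<and>
     (vine_type1 v \<or> vine_type2 v \<or> vine_type3 v \<or> vine_type4 v)"

definition vine_decomposition ::
    "(real \<Rightarrow> diagram) \<Rightarrow> nat \<Rightarrow> (nat \<Rightarrow> real \<Rightarrow> point) \<Rightarrow> bool" where
  "vine_decomposition \<V> m V \<longleftrightarrow> (\<forall>i\<in>{1..m}. vine (V i)) \<and>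
     (\<forall>t\<in>{0..1}. \<V> t = image_mset (\<lambda>i. V i t) (mset_set {1..m}))"


section \<open>Weighted distances\<close>

text \<open>Uniform continuity is with respect to the Euclidean metric of the product type, which is
  equivalent to the sup metric.\<close>

definition weighting_function :: "(point \<Rightarrow> real) \<Rightarrow> bool" where
  "weighting_function w \<longleftrightarrow> uniformly_continuous_on half_plane w \<and>
     (\<forall>p\<in>half_plane. w p \<ge> 0) \<and> (\<forall>p\<in>half_plane - diagonal. w p \<noteq> 0)"

definition weighted_vineyard_distance ::
    "(point \<Rightarrow> real) \<Rightarrow> nat \<Rightarrow> (nat \<Rightarrow> real \<Rightarrow> point) \<Rightarrow> real" where
  "weighted_vineyard_distance w m V = (\<Sum>i=1..m. line_integral w (V i))"

definition weighted_d :: "(point \<Rightarrow> real) \<Rightarrow> point \<Rightarrow> point \<Rightarrow> real" where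
  "weighted_d w p q = d_inf p q * ((w p + w q) / 2)"

definition weighted_d_diag :: "(point \<Rightarrow> real) \<Rightarrow> point \<Rightarrow> real" where
  "weighted_d_diag w \<alpha> = (INF \<delta>\<in>diagonal. weighted_d w \<alpha> \<delta>)"

definition weighted_cost ::
    "(point \<Rightarrow> real) \<Rightarrow> diagram \<Rightarrow> diagram \<Rightarrow> (point \<times> point) multiset \<Rightarrow> real" where
  "weighted_cost w P Q M =
     (\<Sum>(\<alpha>, \<beta>)\<in>#M. weighted_d w \<alpha> \<beta>)
     + (\<Sum>\<alpha>\<in>#P - image_mset fst M. weighted_d_diag w \<alpha>)
     + (\<Sum>\<beta>\<in>#Q - image_mset snd M. weighted_d_diag w \<beta>)"

definition weighted_wasserstein :: "(point \<Rightarrow> real) \<Rightarrow> diagram \<Rightarrow> diagram \<Rightarrow> real" where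
  "weighted_wasserstein w P Q = Min (weighted_cost w P Q ` {M. partial_bijection P Q M})"

end

theory Submission
  imports Defs
begin

text \<open>
  Matching the diagrams at consecutive grid times along the vines bounds the Wasserstein sum from
  above by weighted chord sums, which converge to the line integrals. For the converse, let \<open>V j\<close> be
  a vine that is not close to the diagonal during a short step. Leaving it unmatched or matching it
  far away costs more than the whole step does, so an optimal partial bijection matches it to some
  \<open>V k\<close> that is close to \<open>V j\<close> throughout the step. Replacing \<open>V k\<close> by \<open>V j\<close> there costs at most a constant times the
  arc length that the two vines travel while their distance lies in \<open>(0, \<delta>']\<close>. In total this is the length
  measure of sets that decrease to the empty set as \<open>\<delta>'\<close> tends to \<open>0\<close>. Vines close to the diagonal
  are treated in the same way: by the four types, a vine does not move while it is on the diagonal, so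
  only the arc length travelled at a gap in \<open>(0, \<delta>]\<close> is lost.
\<close>

subsection \<open>The sup metric\<close>

lemma d_inf_commute: "d_inf p q = d_inf q p"
  by (simp add: d_inf_eq_max abs_minus_commute)

lemma d_inf_triangle: "d_inf p r \<le> d_inf p q + d_inf q r"
  by (simp add: d_inf_eq_max) linarith

lemma d_inf_self [simp]: "d_inf p p = 0"
  by (simp add: d_inf_eq_max)

lemma dist_le_2_d_inf: "dist p q \<le> 2 * d_inf p q"
proof -
  have "dist p q \<le> dist (fst p) (fst q) + dist (snd p) (snd q)"
    by (simp add: dist_prod_def sqrt_sum_squares_le_sum)
  also have "\<dots> \<le> 2 * d_inf p q"
    using max.cobounded1[of "\<bar>fst p - fst q\<bar>" "\<bar>snd p - snd q\<bar>"]
      max.cobounded2[of "\<bar>snd p - snd q\<bar>" "\<bar>fst p - fst q\<bar>"]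
    unfolding d_inf_eq_max dist_real_def by linarith
  finally show ?thesis .
qed

lemma d_inf_le_dist: "d_inf p q \<le> dist p q"
  by (simp add: d_inf_def infnorm_le_norm dist_norm)

lemma continuous_on_d_inf [continuous_intros]:
  "continuous_on S f \<Longrightarrow> continuous_on S g \<Longrightarrow> continuous_on S (\<lambda>x. d_inf (f x) (g x))"
  unfolding d_inf_def by (intro continuous_intros)

lemma tendsto_d_inf:
  assumes "(f \<longlongrightarrow> a) F" "(g \<longlongrightarrow> b) F"
  shows "((\<lambda>x. d_inf (f x) (g x)) \<longlongrightarrow> d_inf a b) F"
  unfolding d_inf_def by (intro tendsto_infnorm tendsto_diff assms)

text \<open>Triangle inequality: restoring the indices skipped between \<open>p k\<close> and
  \<open>p (Suc k)\<close> does not shorten the polygon. With \<open>x i\<close> the curve at grid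
  time \<open>i / n\<close>, this compares a coarse polygon with the full chord sum.\<close>

lemma d_inf_polygon:
  assumes "mono_on {..N} p"
  shows "(\<Sum>k<N. d_inf (x (p k)) (x (p (Suc k)))) \<le> (\<Sum>i=p 0..<p N. d_inf (x i) (x (Suc i)))"
  using assms
proof (induction N)
  case (Suc N)
  have *: "p N \<le> p (Suc N)" "p 0 \<le> p N"
    using Suc.prems by (auto simp: mono_on_def)
  have path: "d_inf (x a) (x b) \<le> (\<Sum>i=a..<b. d_inf (x i) (x (Suc i)))" if "a \<le> b" for a b
    using that
  proof (induction rule: dec_induct)
    case (step b)
    then show ?case using d_inf_triangle[of "x a" "x (Suc b)" "x b"] by simp
  qed simp
  have "(\<Sum>i=p 0..<p (Suc N). d_inf (x i) (x (Suc i)))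
    = (\<Sum>i=p 0..<p N. d_inf (x i) (x (Suc i))) + (\<Sum>i=p N..<p (Suc N). d_inf (x i) (x (Suc i)))"
    using * by (simp add: sum.atLeastLessThan_concat)
  then show ?case
    using Suc.IH path[OF *(1)] Suc.prems by (simp add: mono_on_def)
qed simp

section \<open>The uniform grid on the unit interval\<close>

lemma grid_in_unit [simp]:
  assumes "i \<in> {1..n}"
  shows "real i / real n \<in> {0..1}" "(real i - 1) / real n \<in> {0..1}"
    "0 \<le> real i / real n" "real i / real n \<le> 1" "0 \<le> (real i - 1) / real n" "(real i - 1) / real n \<le> 1"
    "(real i - 1) / real n \<le> real i / real n"
  using assms by (auto simp: divide_simps)

lemma sum_grid_telescope:
  fixes f :: "real \<Rightarrow> real"
  assumes "n > 0"
  shows "(\<Sum>i=1..n. f (real i / real n) - f ((real i - 1) / real n)) = f 1 - f 0"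
proof -
  have "(\<Sum>i=1..n. f (real i / real n) - f ((real i - 1) / real n))
      = (\<Sum>i<n. f (real (Suc i) / real n) - f (real i / real n))"
    by (rule sum.reindex_bij_witness[of _ Suc "\<lambda>i. i - 1"]) (auto simp: of_nat_diff)
  also have "\<dots> = f (real n / real n) - f (real 0 / real n)"
    by (rule sum_lessThan_telescope)
  finally show ?thesis using assms by simp
qed


subsection \<open>Arc length\<close>

lemma arc_length_mono:
  assumes "rectifiable v" "0 \<le> s" "s \<le> t" "t \<le> 1"
  shows "arc_length v s \<le> arc_length v t"
  using arc_length_extend[OF assms] d_inf_nonneg[of "v s" "v t"] by linarith

lemma polygon_lengths_nonempty:
  assumes "a \<le> b"
  shows "polygon_lengths v a b \<noteq> {}"
proof -
  have "0 \<in> polygon_lengths v a a"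
    by (auto simp: polygon_lengths_def intro!: exI[of _ "0::nat"] exI[of _ "\<lambda>_. a"] mono_onI)
  then show ?thesis
    using polygon_lengths_extend[OF _ assms] by blast
qed

lemma arc_length_0 [simp]: "arc_length v 0 = 0"
proof -
  have "l = 0" if l: "l \<in> polygon_lengths v 0 0" for l
  proof -
    obtain n t where l: "l = (\<Sum>k<n. d_inf (v (t k)) (v (t (Suc k))))"
      and t: "mono_on {..n} t" "t 0 = 0" "t n = 0"
      using l by (auto simp: polygon_lengths_def)
    have "t k = 0" if "k \<le> n" for k
      using mono_onD[OF t(1), of 0 k] mono_onD[OF t(1), of k n] t that by auto
    then show ?thesis by (simp add: l)
  qed
  then have "polygon_lengths v 0 0 = {0}"
    using polygon_lengths_nonempty[of 0 0 v] by auto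
  then show ?thesis
    by (simp add: arc_length_def)
qed

lemma arc_length_nonneg: "rectifiable v \<Longrightarrow> 0 \<le> t \<Longrightarrow> t \<le> 1 \<Longrightarrow> 0 \<le> arc_length v t"
  using arc_length_mono[of v 0 t] by simp

lemma d_inf_le_arc_length:
  assumes "rectifiable v" "0 \<le> s" "s \<le> t" "t \<le> 1"
  shows "d_inf (v s) (v t) \<le> arc_length v t - arc_length v s"
  using arc_length_extend[OF assms] by linarith

text \<open>Clamping the parameters of a polygon to \<open>[0, a]\<close> changes none of its points, as the curve is
  constant on \<open>[a, b]\<close>.\<close>

lemma arc_length_const:
  assumes "rectifiable v" "0 \<le> a" "a \<le> b" "b \<le> 1" and const: "\<And>t. t \<in> {a..b} \<Longrightarrow> v t = c"
  shows "arc_length v b = arc_length v a"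
proof (rule antisym)
  have bdd: "bdd_above (polygon_lengths v 0 a)"
  proof -
    obtain B where B: "\<And>l. l \<in> polygon_lengths v 0 1 \<Longrightarrow> l \<le> B"
      using assms(1) by (auto simp: rectifiable_def bdd_above_def)
    have "l \<le> B" if "l \<in> polygon_lengths v 0 a" for l
      using B[OF polygon_lengths_extend[OF that]] d_inf_nonneg[of "v a" "v 1"] assms by fastforce
    then show ?thesis by (auto simp: bdd_above_def)
  qed
  show "arc_length v b \<le> arc_length v a"
    unfolding arc_length_def[of v b]
  proof (rule cSup_least[OF polygon_lengths_nonempty])
    fix l assume "l \<in> polygon_lengths v 0 b"
    then obtain n t where l: "l = (\<Sum>k<n. d_inf (v (t k)) (v (t (Suc k))))"
      and t: "mono_on {..n} t" "t 0 = 0" "t n = b"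
      by (auto simp: polygon_lengths_def)
    have t_le: "t k \<le> b" if "k \<le> n" for k
      using mono_onD[OF t(1), of k n] t that by auto
    have v_min: "v (min (t k) a) = v (t k)" if "k \<le> n" for k
      using const[of a] const[of "t k"] t_le[OF that] assms by (cases "t k \<le> a") auto
    have "l = (\<Sum>k<n. d_inf (v (min (t k) a)) (v (min (t (Suc k)) a)))"
      unfolding l by (intro sum.cong) (simp_all add: v_min)
    also have "\<dots> \<in> polygon_lengths v 0 a"
      unfolding polygon_lengths_def
    proof (intro CollectI exI[of _ n] exI[of _ "\<lambda>k. min (t k) a"] conjI refl)
      show "mono_on {..n} (\<lambda>k. min (t k) a)"
        by (intro mono_onI min.mono mono_onD[OF t(1)]) auto
      show "min (t 0) a = 0" "min (t n) a = a"
        using t assms by auto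
    qed
    finally show "l \<le> arc_length v a"
      unfolding arc_length_def using bdd by (rule cSup_upper)
  qed (use assms in auto)
  show "arc_length v a \<le> arc_length v b"
    by (rule arc_length_mono) (use assms in auto)
qed

section \<open>Chord sums over uniform grids\<close>

lemma chord_sum_le_arc_length:
  assumes "rectifiable v" "n > 0"
  shows "(\<Sum>i=1..n. d_inf (v (real i / real n)) (v ((real i - 1) / real n))) \<le> arc_length v 1"
proof -
  have "(\<Sum>i=1..n. d_inf (v (real i / real n)) (v ((real i - 1) / real n)))
     \<le> (\<Sum>i=1..n. arc_length v (real i / real n) - arc_length v ((real i - 1) / real n))"
    by (subst d_inf_commute, intro sum_mono d_inf_le_arc_length) (use assms grid_in_unit in auto)
  then show ?thesis
    using sum_grid_telescope[OF assms(2), of "arc_length v"] by simp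
qed

lemma floor_grid_tendsto: "(\<lambda>n. real (nat \<lfloor>real n * x\<rfloor>) / real n) \<longlonglongrightarrow> x" if "0 \<le> x" for x :: real
proof (rule tendsto_sandwich[of "\<lambda>n. x - 1 / real n" _ _ "\<lambda>n. x"])
  show "eventually (\<lambda>n. x - 1 / real n \<le> real (nat \<lfloor>real n * x\<rfloor>) / real n) sequentially"
    using eventually_gt_at_top[of 0]
  proof eventually_elim
    case (elim n)
    have "real n * x - 1 \<le> real (nat \<lfloor>real n * x\<rfloor>)"
      using that by linarith
    then have "(real n * x - 1) / real n \<le> real (nat \<lfloor>real n * x\<rfloor>) / real n"
      by (rule divide_right_mono) simp
    then show ?case using elim by (simp add: diff_divide_distrib)
  qed
  show "eventually (\<lambda>n. real (nat \<lfloor>real n * x\<rfloor>) / real n \<le> x) sequentially"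
    using eventually_gt_at_top[of 0]
  proof eventually_elim
    case (elim n)
    have "real (nat \<lfloor>real n * x\<rfloor>) \<le> real n * x"
      using that by (simp add: of_nat_floor)
    then show ?case using elim by (simp add: field_simps)
  qed
  show "(\<lambda>n. x - 1 / real n) \<longlonglongrightarrow> x"
    using tendsto_diff[OF tendsto_const lim_1_over_n, of x] by simp
qed simp

text \<open>The grid times need not contain the vertices of a given polygon, so these are rounded to
  the grid. By continuity this hardly changes the length of an almost optimal polygon, and by
  \<open>d_inf_polygon\<close> the chord sum over the whole grid is at least as long.\<close>

lemma chord_sum_tendsto_arc_length:
  assumes "rectifiable v" "continuous_on {0..1} v"
  shows "(\<lambda>n. \<Sum>i=1..n. d_inf (v (real i / real n)) (v ((real i - 1) / real n)))
    \<longlonglongrightarrow> arc_length v 1"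
proof (rule order_tendstoI)
  fix y assume "arc_length v 1 < y"
  show "\<forall>\<^sub>F n in sequentially. (\<Sum>i=1..n. d_inf (v (real i / real n)) (v ((real i - 1) / real n))) < y"
    using eventually_gt_at_top[of 0]
    by eventually_elim
      (use chord_sum_le_arc_length[OF assms(1)] \<open>arc_length v 1 < y\<close> in \<open>auto intro: order_le_less_trans\<close>)
next
  fix y assume "y < arc_length v 1"
  then obtain l where "l \<in> polygon_lengths v 0 1" "y < l"
    unfolding arc_length_def using less_cSupE[OF _ polygon_lengths_nonempty] by (metis zero_le_one)
  then obtain N t where l: "y < (\<Sum>k<N. d_inf (v (t k)) (v (t (Suc k))))"
    and t: "mono_on {..N} t" "t 0 = 0" "t N = 1"
    by (auto simp: polygon_lengths_def)
  have t01: "t k \<in> {0..1}" if "k \<le> N" for k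
    using mono_onD[OF t(1), of 0 k] mono_onD[OF t(1), of k N] t that by auto
  \<comment> \<open>Grid index of the last grid point not after the vertex \<open>t k\<close>.
    Rounding down keeps the order of the vertices and fixes the end points \<open>0\<close> and
    \<open>1\<close>.\<close>
  define p where "p n k = nat \<lfloor>real n * t k\<rfloor>" for n k
  have "(\<lambda>n. v (real (p n k) / real n)) \<longlonglongrightarrow> v (t k)" if "k \<le> N" for k
  proof (rule continuous_on_tendsto_compose[OF assms(2)])
    show "(\<lambda>n. real (p n k) / real n) \<longlonglongrightarrow> t k"
      unfolding p_def by (rule floor_grid_tendsto) (use t01[OF that] in auto)
    show "\<forall>\<^sub>F n in sequentially. real (p n k) / real n \<in> {0..1}"
      using eventually_gt_at_top[of 0]
    proof eventually_elim
      case (elim n)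
      have "real n * t k \<le> real n"
        using t01[OF that] by (simp add: mult_left_le)
      then have "p n k \<le> n"
        unfolding p_def by (simp add: nat_le_iff floor_le_iff)
      then show ?case using elim by simp
    qed
  qed (use t01[OF that] in auto)
  then have "(\<lambda>n. \<Sum>k<N. d_inf (v (real (p n k) / real n)) (v (real (p n (Suc k)) / real n)))
      \<longlonglongrightarrow> (\<Sum>k<N. d_inf (v (t k)) (v (t (Suc k))))"
    by (intro tendsto_sum tendsto_d_inf) auto
  from order_tendstoD(1)[OF this l] eventually_gt_at_top[of 0]
  show "\<forall>\<^sub>F n in sequentially. y < (\<Sum>i=1..n. d_inf (v (real i / real n)) (v ((real i - 1) / real n)))"
  proof eventually_elim
    case (elim n)
    have "mono_on {..N} (p n)"
      by (auto simp: p_def mono_on_def intro!: nat_mono floor_mono mult_left_mono mono_onD[OF t(1)])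
    moreover have "p n 0 = 0" "p n N = n"
      by (simp_all add: p_def t)
    ultimately have "(\<Sum>k<N. d_inf (v (real (p n k) / real n)) (v (real (p n (Suc k)) / real n)))
        \<le> (\<Sum>i=0..<n. d_inf (v (real i / real n)) (v (real (Suc i) / real n)))"
      using d_inf_polygon[of N "p n" "\<lambda>i. v (real i / real n)"] by simp
    also have "\<dots> = (\<Sum>i=1..n. d_inf (v (real i / real n)) (v ((real i - 1) / real n)))"
      by (rule sum.reindex_bij_witness[of _ "\<lambda>i. i - 1" Suc]) (auto simp: of_nat_diff d_inf_commute)
    finally show ?case using elim by linarith
  qed
qed

lemma eventually_grid_close:
  fixes f :: "real \<Rightarrow> 'a::metric_space"
  assumes "continuous_on {0..1} f" "e > 0"
  shows "\<forall>\<^sub>F n in sequentially. \<forall>i\<in>{1..n}. \<forall>s\<in>{(real i - 1) / real n..real i / real n}.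
     \<forall>t\<in>{(real i - 1) / real n..real i / real n}. dist (f s) (f t) < e"
proof -
  have "uniformly_continuous_on {0..1} f"
    using assms by (intro compact_uniformly_continuous) auto
  then obtain d where d: "d > 0" "\<And>s t. s \<in> {0..1} \<Longrightarrow> t \<in> {0..1} \<Longrightarrow> dist s t < d \<Longrightarrow> dist (f s) (f t) < e"
    using assms(2) unfolding uniformly_continuous_on_def by metis
  have "\<forall>\<^sub>F n in sequentially. 1 / real n < d"
    using lim_1_over_n d(1) by (rule order_tendstoD)
  then show ?thesis
  proof eventually_elim
    case (elim n)
    show ?case
    proof (intro ballI)
      fix i s t assume i: "i \<in> {1..n}"
        and st: "s \<in> {(real i - 1) / real n..real i / real n}" "t \<in> {(real i - 1) / real n..real i / real n}"
      have "dist s t \<le> real i / real n - (real i - 1) / real n"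
        using st by (auto simp: dist_real_def)
      also have "\<dots> = 1 / real n"
        by (simp add: diff_divide_distrib[symmetric])
      finally show "dist (f s) (f t) < e"
        using st elim grid_in_unit[OF i] by (intro d(2)) auto
    qed
  qed
qed

text \<open>The increment of the arc length over a grid interval exceeds the chord by at most the total
  defect of the chord sum.\<close>

lemma continuous_on_arc_length:
  assumes v: "rectifiable v" "continuous_on {0..1} v"
  shows "continuous_on {0..1} (arc_length v)"
proof -
  let ?F = "arc_length v"
  let ?ch = "\<lambda>n i. d_inf (v (real i / real n)) (v ((real i - 1) / real n))"
  have "\<exists>d>0. \<forall>s\<in>{0..1}. \<forall>t\<in>{0..1}. s \<le> t \<and> t - s < d \<longrightarrow> ?F t - ?F s < e" if "e > 0" for e
  proof -
    \<comment> \<open>The arc over one grid interval is its chord plus its defect, each below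
      \<open>e / 4\<close>. Two adjacent intervals then stay below \<open>e\<close>.\<close>
    have e4: "e / 4 > 0" using that by simp
    have "\<forall>\<^sub>F n in sequentially. ?F 1 - e / 4 < (\<Sum>i=1..n. ?ch n i)"
      by (rule order_tendstoD(1)[OF chord_sum_tendsto_arc_length[OF v]]) (use that in simp)
    then have "\<forall>\<^sub>F n in sequentially. \<forall>i\<in>{1..n}. ?F (real i / real n) - ?F ((real i - 1) / real n) < e / 2"
      using eventually_grid_close[OF v(2) e4] eventually_gt_at_top[of 0]
    proof eventually_elim
      case (elim n)
      have defect: "0 \<le> ?F (real i / real n) - ?F ((real i - 1) / real n) - ?ch n i" if "i \<in> {1..n}" for i
        using d_inf_le_arc_length[OF v(1) grid_in_unit(5,7,4)[OF that]] by (simp add: d_inf_commute)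
      show ?case
      proof
        fix i assume i: "i \<in> {1..n}"
        have "?F (real i / real n) - ?F ((real i - 1) / real n) - ?ch n i
          \<le> (\<Sum>i=1..n. ?F (real i / real n) - ?F ((real i - 1) / real n) - ?ch n i)"
          using i defect by (intro member_le_sum) auto
        also have "\<dots> = ?F 1 - (\<Sum>i=1..n. ?ch n i)"
          using sum_grid_telescope[of n ?F] elim by (simp add: sum_subtractf)
        also have "\<dots> < e / 4" using elim by simp
        moreover have "?ch n i < e / 4"
          using elim(2) i grid_in_unit(7)[OF i]
          by (intro order_le_less_trans[OF d_inf_le_dist]) auto
        ultimately show "?F (real i / real n) - ?F ((real i - 1) / real n) < e / 2" by simp
      qed
    qed
    from eventually_happens'[OF sequentially_bot eventually_conj[OF this eventually_gt_at_top[of 0]]]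
    obtain n where n: "n > 0" "\<And>i. i \<in> {1..n} \<Longrightarrow> ?F (real i / real n) - ?F ((real i - 1) / real n) < e / 2"
      by blast
    have "?F t - ?F s < e" if st: "s \<in> {0..1}" "t \<in> {0..1}" "s \<le> t" "t - s < 1 / real n" for s t
    proof (cases "s = 1")
      case True
      then show ?thesis using st \<open>e > 0\<close> by simp
    next
      case False
      \<comment> \<open>\<open>s\<close> lies in \<open>[(i - 1) / n, i / n)\<close>, so
        \<open>t\<close> reaches at most into the next grid interval. The excluded
        \<open>s = 1\<close> would give \<open>i = n + 1\<close>.\<close>
      define i where "i = Suc (nat \<lfloor>real n * s\<rfloor>)"
      have fl: "real i - 1 \<le> real n * s" "real n * s < real i"
        using st by (auto simp: i_def) linarith
      have "real n * s < real n" using False st n(1) by simp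
      then have i: "i \<in> {1..n}" using fl by (auto simp: i_def)
      have *: "(real i - 1) / real n \<le> s" using fl n(1) by (simp add: field_simps)
      have 1: "?F s \<ge> ?F ((real i - 1) / real n)"
        using * st grid_in_unit[OF i] by (intro arc_length_mono v) auto
      have t: "t \<le> (real i + 1) / real n"
        using st(4) fl n(1) by (simp add: field_simps)
      show ?thesis
      proof (cases "i = n")
        case True
        then have "?F t \<le> ?F (real i / real n)"
          using st n(1) by (intro arc_length_mono v) auto
        then show ?thesis using 1 n(2)[OF i] \<open>e > 0\<close> by linarith
      next
        case False
        then have i': "Suc i \<in> {1..n}" using i by auto
        have "?F t \<le> ?F (real (Suc i) / real n)"
          using st t grid_in_unit[OF i'] by (intro arc_length_mono v) (auto simp: add.commute)
        then show ?thesis using 1 n(2)[OF i] n(2)[OF i'] by simp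
      qed
    qed
    then show ?thesis using n(1) by (intro exI[of _ "1 / real n"]) auto
  qed note * = this
  have "uniformly_continuous_on {0..1} ?F"
    unfolding uniformly_continuous_on_def
  proof (intro allI impI)
    fix e :: real assume "e > 0"
    from *[OF this] obtain d where d: "d > 0"
      "\<And>s t. s \<in> {0..1} \<Longrightarrow> t \<in> {0..1} \<Longrightarrow> s \<le> t \<Longrightarrow> t - s < d \<Longrightarrow> ?F t - ?F s < e" by blast
    have "dist (?F t) (?F s) < e" if "s \<in> {0..1}" "t \<in> {0..1}" "dist t s < d" for s t
    proof (cases "s \<le> t")
      case True
      then show ?thesis using d(2)[of s t] that arc_length_mono[OF v(1), of s t] by (auto simp: dist_real_def)
    next
      case False
      then show ?thesis using d(2)[of t s] that arc_length_mono[OF v(1), of t s] by (auto simp: dist_real_def)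
    qed
    then show "\<exists>d>0. \<forall>x\<in>{0..1}. \<forall>x'\<in>{0..1}. dist x' x < d \<longrightarrow> dist (?F x') (?F x) < e"
      using d(1) by blast
  qed
  then show ?thesis by (rule uniformly_continuous_imp_continuous)
qed


subsection \<open>Line integrals as limits of chord sums\<close>

lemma weighting_function_nonneg:
  "weighting_function w \<Longrightarrow> p \<in> half_plane \<Longrightarrow> 0 \<le> w p"
  by (simp add: weighting_function_def)

lemma weighting_function_continuous: "weighting_function w \<Longrightarrow> continuous_on half_plane w"
  by (auto simp: weighting_function_def intro: uniformly_continuous_imp_continuous)

lemma weighting_function_modulus:
  assumes "weighting_function w" "e > 0"
  obtains d where "d > 0"
    "\<And>p q. p \<in> half_plane \<Longrightarrow> q \<in> half_plane \<Longrightarrow> d_inf p q \<le> d \<Longrightarrow> \<bar>w p - w q\<bar> < e"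
proof -
  obtain d where d: "d > 0" "\<And>p q. p \<in> half_plane \<Longrightarrow> q \<in> half_plane \<Longrightarrow> dist p q < d \<Longrightarrow> dist (w p) (w q) < e"
    using assms unfolding weighting_function_def uniformly_continuous_on_def by metis
  show ?thesis
  \<comment> \<open>\<open>dist\<close> is at most twice \<open>d_inf\<close>, and
    \<open>2 * (d / 3)\<close> is strictly below \<open>d\<close>.\<close>
  proof (rule that[of "d / 3"])
    fix p q assume pq: "p \<in> half_plane" "q \<in> half_plane" "d_inf p q \<le> d / 3"
    have "dist p q \<le> 2 * d_inf p q" by (rule dist_le_2_d_inf)
    also have "\<dots> < d" using pq(3) d(1) by simp
    finally show "\<bar>w p - w q\<bar> < e" using d(2)[OF pq(1,2)] by (simp add: dist_real_def)
  qed (use d in simp)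
qed

lemma weighting_function_bounded:
  assumes "weighting_function w" "continuous_on {0..1} v" "v ` {0..1} \<subseteq> half_plane"
  obtains B where "B > 0" "\<And>t. t \<in> {0..1::real} \<Longrightarrow> w (v t) \<le> B"
proof -
  have "compact ((\<lambda>t. w (v t)) ` {0..1})"
    by (intro compact_continuous_image continuous_on_compose2[OF weighting_function_continuous[OF assms(1)]] assms)
      auto
  then obtain B where "\<And>t. t \<in> {0..1} \<Longrightarrow> norm (w (v t)) \<le> B"
    using compact_imp_bounded bounded_iff by (metis imageI)
  then have "w (v t) \<le> max B 1" if "t \<in> {0..1}" for t
    using that by fastforce
  then show ?thesis by (intro that[of "max B 1"]) auto
qed

section \<open>The arc length parametrisation\<close>

lemma arc_length_surj:
  assumes "rectifiable v" "continuous_on {0..1} v" "s \<in> {0..arc_length v 1}"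
  obtains t where "t \<in> {0..1}" "arc_length v t = s"
  using IVT'[of "arc_length v" 0 s 1] continuous_on_arc_length[OF assms(1,2)] assms(3) by auto

lemma arc_length_param_in_image:
  assumes "rectifiable v" "continuous_on {0..1} v" "s \<in> {0..arc_length v 1}"
  shows "arc_length_param v s \<in> v ` {0..1}"
  using arc_length_surj[OF assms] arc_length_param_arc_length[OF assms(1)] by (metis imageI)

text \<open>Both points are values of \<open>v\<close> at times with arc lengths \<open>s\<close>
  and \<open>s'\<close>, and a chord is no longer than its arc. The bound makes the integrand of
  \<open>line_integral\<close> continuous.\<close>

lemma d_inf_arc_length_param:
  assumes v: "rectifiable v" "continuous_on {0..1} v"
    and s: "s \<in> {0..arc_length v 1}" "s' \<in> {0..arc_length v 1}"
  shows "d_inf (arc_length_param v s) (arc_length_param v s') \<le> \<bar>s - s'\<bar>"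
proof -
  obtain t where t: "t \<in> {0..1}" "arc_length v t = s"
    using arc_length_surj[OF v s(1)] .
  obtain t' where t': "t' \<in> {0..1}" "arc_length v t' = s'"
    using arc_length_surj[OF v s(2)] .
  have eq: "arc_length_param v s = v t" "arc_length_param v s' = v t'"
    using arc_length_param_arc_length[OF v(1)] t t' by auto
  show ?thesis
  proof (cases "t \<le> t'")
    case True
    then show ?thesis
      using d_inf_le_arc_length[OF v(1), of t t'] t t' by (auto simp: eq)
  next
    case False
    then show ?thesis
      using d_inf_le_arc_length[OF v(1), of t' t] t t' by (auto simp: eq d_inf_commute[of "v t"])
  qed
qed

text \<open>Cuts the range of integration at the values of \<open>F\<close> at grid times. A curve
  may rest, so \<open>F\<close> need only be weakly monotone; degenerate pieces contribute
  \<open>0\<close>.\<close>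

lemma integral_sum_grid:
  fixes f F :: "real \<Rightarrow> real"
  assumes f: "f integrable_on {F 0..F 1}" and F: "mono_on {0..1} F" and n: "n > 0"
  shows "(\<Sum>i=1..n. integral {F ((real i - 1) / real n)..F (real i / real n)} f) = integral {F 0..F 1} f"
proof -
  have Fm: "F a \<le> F b" if "0 \<le> a" "a \<le> b" "b \<le> 1" for a b
    using that F by (auto simp: mono_on_def)
  have "(\<Sum>i=1..k. integral {F ((real i - 1) / real n)..F (real i / real n)} f) = integral {F 0..F (real k / real n)} f"
    if "k \<le> n" for k
    using that
  proof (induction k)
    case (Suc k)
    have k: "real k / real n \<le> real (Suc k) / real n" "real (Suc k) / real n \<le> 1"
      using Suc.prems n by (auto simp: divide_simps)
    have "integral {F 0..F (real k / real n)} f + integral {F (real k / real n)..F (real (Suc k) / real n)} f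
       = integral {F 0..F (real (Suc k) / real n)} f"
      by (intro Henstock_Kurzweil_Integration.integral_combine Fm k integrable_on_subinterval[OF f])
        (use k in \<open>auto intro!: Fm\<close>)
    then show ?case using Suc by simp
  qed simp
  from this[of n] show ?thesis using n by simp
qed

text \<open>On a grid interval with arc length running from \<open>a\<close> to \<open>b\<close>,
  both quantities are compared with \<open>(b - a) * c\<close>, where \<open>c\<close> is the mean
  of the end weights. The integral is off by at most \<open>e * (b - a)\<close>, as the weight
  hardly varies there; the weighted chord is off by at most \<open>B\<close> times the defect of the
  chord. The defects add up to \<open>?F 1\<close> minus the chord sum, which tends to
  \<open>0\<close>.\<close>

lemma weighted_chord_sum_tendsto_line_integral:
  assumes w: "weighting_function w" and v: "rectifiable v" "continuous_on {0..1} v"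
    and half: "v ` {0..1} \<subseteq> half_plane"
  shows "(\<lambda>n. \<Sum>i=1..n. weighted_d w (v (real i / real n)) (v ((real i - 1) / real n)))
    \<longlonglongrightarrow> line_integral w v"
proof (rule LIMSEQ_I)
  fix r :: real assume "r > 0"
  let ?F = "arc_length v" and ?f = "\<lambda>s. w (arc_length_param v s)"
  let ?ch = "\<lambda>n i. d_inf (v (real i / real n)) (v ((real i - 1) / real n))"
  let ?avg = "\<lambda>n i. (w (v (real i / real n)) + w (v ((real i - 1) / real n))) / 2"
  \<comment> \<open>Gives \<open>e * ?F 1 < r / 2\<close>; the \<open>1\<close> in the denominator
    covers curves of length \<open>0\<close>.\<close>
  define e where "e = r / (2 * (?F 1 + 1))"
  have F1: "0 \<le> ?F 1" by (rule arc_length_nonneg) (use v in auto)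
  then have e: "e > 0" "e * ?F 1 < r / 2"
    using \<open>r > 0\<close> by (auto simp: e_def field_simps)
  obtain d where d: "d > 0"
    "\<And>p q. p \<in> half_plane \<Longrightarrow> q \<in> half_plane \<Longrightarrow> d_inf p q \<le> d \<Longrightarrow> \<bar>w p - w q\<bar> < e"
    using weighting_function_modulus[OF w e(1)] by blast
  obtain B where B: "B > 0" "\<And>t. t \<in> {0..1} \<Longrightarrow> w (v t) \<le> B"
    using weighting_function_bounded[OF w v(2) half] by blast
  have param_half: "arc_length_param v s \<in> half_plane" if "s \<in> {0..?F 1}" for s
    using arc_length_param_in_image[OF v that] half by auto
  have close: "\<bar>?f s - ?f s'\<bar> < e" if "s \<in> {0..?F 1}" "s' \<in> {0..?F 1}" "\<bar>s - s'\<bar> \<le> d" for s s'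
    using d(2) d_inf_arc_length_param[OF v that(1,2)] param_half that by (meson order_trans)
  have "continuous_on {0..?F 1} (arc_length_param v)"
    unfolding continuous_on_iff
  proof (intro ballI allI impI)
    fix s and \<epsilon> :: real assume "s \<in> {0..?F 1}" "\<epsilon> > 0"
    show "\<exists>d>0. \<forall>s'\<in>{0..?F 1}. dist s' s < d \<longrightarrow> dist (arc_length_param v s') (arc_length_param v s) < \<epsilon>"
    proof (intro exI[of _ "\<epsilon> / 2"] conjI ballI impI)
      fix s' assume s': "s' \<in> {0..?F 1}" "dist s' s < \<epsilon> / 2"
      have "dist (arc_length_param v s') (arc_length_param v s) \<le> 2 * \<bar>s' - s\<bar>"
        using dist_le_2_d_inf d_inf_arc_length_param[OF v s'(1) \<open>s \<in> {0..?F 1}\<close>]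
        by (metis mult_left_mono order_trans zero_le_numeral)
      then show "dist (arc_length_param v s') (arc_length_param v s) < \<epsilon>"
        using s'(2) by (simp add: dist_real_def)
    qed (use \<open>\<epsilon> > 0\<close> in simp)
  qed
  then have f_cont: "continuous_on {0..?F 1} ?f"
    by (rule continuous_on_compose2[OF weighting_function_continuous[OF w]]) (use param_half in auto)
  have mono: "mono_on {0..1} ?F"
    using arc_length_mono[OF v(1)] by (auto intro: mono_onI)
  \<comment> \<open>With this bound on the total defect, the error coming from the chords stays
    below the other \<open>r / 2\<close>.\<close>
  have "\<forall>\<^sub>F n in sequentially. ?F 1 - r / (2 * B) < (\<Sum>i=1..n. ?ch n i)"
    by (rule order_tendstoD(1)[OF chord_sum_tendsto_arc_length[OF v]]) (use \<open>r > 0\<close> B(1) in simp)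
  then have "\<forall>\<^sub>F n in sequentially. norm ((\<Sum>i=1..n. weighted_d w (v (real i / real n)) (v ((real i - 1) / real n)))
      - line_integral w v) < r"
    using eventually_grid_close[OF continuous_on_arc_length[OF v] d(1)] eventually_gt_at_top[of 0]
  proof eventually_elim
    case (elim n)
    have step: "\<bar>weighted_d w (v (real i / real n)) (v ((real i - 1) / real n))
        - integral {?F ((real i - 1) / real n)..?F (real i / real n)} ?f\<bar>
      \<le> e * (?F (real i / real n) - ?F ((real i - 1) / real n))
        + B * (?F (real i / real n) - ?F ((real i - 1) / real n) - ?ch n i)"
      if i: "i \<in> {1..n}" for i
    proof -
      define a b where "a = ?F ((real i - 1) / real n)" and "b = ?F (real i / real n)"
      define c where "c = ?avg n i"
      have ab: "0 \<le> a" "a \<le> b" "b \<le> ?F 1"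
        unfolding a_def b_def using grid_in_unit[OF i] by (auto intro!: arc_length_nonneg arc_length_mono v)
      have "\<bar>a - b\<bar> \<le> d"
        using elim(2)[rule_format, OF i, of "(real i - 1) / real n" "real i / real n"] grid_in_unit(7)[OF i]
        by (simp add: a_def b_def dist_real_def)
      then have ba: "b - a \<le> d" by simp
      have fab: "?f a = w (v ((real i - 1) / real n))" "?f b = w (v (real i / real n))"
        unfolding a_def b_def using arc_length_param_arc_length[OF v(1)] grid_in_unit(1,2)[OF i] by auto
      have fc: "norm (?f s - c) \<le> e" if "s \<in> {a..b}" for s
      proof -
        have "\<bar>?f s - ?f a\<bar> < e" "\<bar>?f s - ?f b\<bar> < e"
          using that ab ba by (intro close; auto)+
        then show ?thesis unfolding c_def fab by (simp add: abs_if field_simps split: if_splits)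
      qed
      have int: "?f integrable_on {a..b}"
        using ab by (intro integrable_continuous_real continuous_on_subset[OF f_cont]) auto
      have "((\<lambda>s. ?f s - c) has_integral (integral {a..b} ?f - (b - a) * c)) {a..b}"
        using has_integral_diff[OF integrable_integral[OF int] has_integral_const_real[of c a b]] ab by simp
      then have 1: "\<bar>integral {a..b} ?f - (b - a) * c\<bar> \<le> e * (b - a)"
        using has_integral_bound_real[where B = e and f = "\<lambda>s. ?f s - c" and a = a and b = b] fc e(1) ab by (auto simp: content_real)
      have c: "0 \<le> c" "c \<le> B"
        unfolding c_def using B(2)[OF grid_in_unit(1)[OF i]] B(2)[OF grid_in_unit(2)[OF i]]
          weighting_function_nonneg[OF w, of "v (real i / real n)"]
          weighting_function_nonneg[OF w, of "v ((real i - 1) / real n)"]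
          half grid_in_unit(1,2)[OF i] by (auto simp: image_subset_iff)
      have ch: "?ch n i \<le> b - a"
        unfolding a_def b_def
        using d_inf_le_arc_length[OF v(1) grid_in_unit(5,7,4)[OF i]] by (simp add: d_inf_commute)
      then have "\<bar>?ch n i * c - (b - a) * c\<bar> \<le> B * (b - a - ?ch n i)"
        using c mult_right_mono[OF c(2), of "b - a - ?ch n i"] mult_right_mono[OF ch c(1)] by (simp add: algebra_simps abs_if)
      then show ?thesis
        using 1 unfolding weighted_d_def c_def[symmetric] a_def[symmetric] b_def[symmetric] by linarith
    qed
    have "norm ((\<Sum>i=1..n. weighted_d w (v (real i / real n)) (v ((real i - 1) / real n))) - line_integral w v)
      = \<bar>\<Sum>i=1..n. weighted_d w (v (real i / real n)) (v ((real i - 1) / real n))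
          - integral {?F ((real i - 1) / real n)..?F (real i / real n)} ?f\<bar>"
      using integral_sum_grid[of ?f ?F n] integrable_continuous_real[OF f_cont] mono elim(3)
      by (simp add: line_integral_def sum_subtractf)
    also have "\<dots> \<le> (\<Sum>i=1..n. e * (?F (real i / real n) - ?F ((real i - 1) / real n))
        + B * (?F (real i / real n) - ?F ((real i - 1) / real n) - ?ch n i))"
      using step by (intro order_trans[OF sum_abs] sum_mono) auto
    also have "\<dots> = e * ?F 1 + B * (?F 1 - (\<Sum>i=1..n. ?ch n i))"
      unfolding sum.distrib sum_distrib_left[symmetric] sum_subtractf[of _ "?ch n"]
      using sum_grid_telescope[of n ?F] elim(3) by simp
    also have "\<dots> < r"
    proof -
      have "B * (?F 1 - (\<Sum>i=1..n. ?ch n i)) < B * (r / (2 * B))"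
        using elim(1) B(1) by (intro mult_strict_left_mono) auto
      then show ?thesis using e(2) B(1) by simp
    qed
    finally show ?case .
  qed
  then show "\<exists>no. \<forall>n\<ge>no. norm ((\<Sum>i=1..n. weighted_d w (v (real i / real n)) (v ((real i - 1) / real n)))
      - line_integral w v) < r"
    by (simp add: eventually_sequentially)
qed


subsection \<open>The length measure of a curve\<close>

text \<open>The Lebesgue-Stieltjes measure of the arc length. Clamping the time extends the arc
  length to a monotone function on the whole line, constant outside \<open>[0, 1]\<close>.\<close>

definition length_measure :: "(real \<Rightarrow> point) \<Rightarrow> real measure" where
  "length_measure v = interval_measure (\<lambda>t. arc_length v (max 0 (min 1 t)))"

lemma sets_length_measure [simp, measurable_cong]: "sets (length_measure v) = sets borel"
  by (simp add: length_measure_def)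

text \<open>Contact times, where \<open>h t = 0\<close>, are left out so that the sets shrink to the
  empty set as \<open>d\<close> tends to \<open>0\<close>. The domain is half-open so that half-open
  grid intervals partition it.\<close>

definition level_set :: "(real \<Rightarrow> real) \<Rightarrow> real \<Rightarrow> real set" where
  "level_set h d = {t \<in> {0<..1}. 0 < h t \<and> h t \<le> d}"

lemma level_set_subset: "level_set h d \<subseteq> {0<..1}"
  by (auto simp: level_set_def)

lemma borel_measurable_sublevel:
  fixes h :: "real \<Rightarrow> real"
  assumes "continuous_on {0..1} h"
  shows "{t \<in> {0<..1}. h t = 0} \<in> sets borel" "level_set h d \<in> sets borel"
proof -
  \<comment> \<open>Extending \<open>h\<close> by \<open>0\<close> outside \<open>[0, 1]\<close>
    gives a Borel function on the whole line.\<close>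
  define g where "g t = indicator {0..1} t *\<^sub>R h t" for t
  have [measurable]: "g \<in> borel_measurable borel"
    unfolding g_def by (rule borel_measurable_continuous_on_indicator) (use assms in auto)
  have "{t \<in> {0<..1}. h t = 0} = {t \<in> space borel. t \<in> {0<..1} \<and> g t = 0}"
    by (auto simp: g_def)
  then show "{t \<in> {0<..1}. h t = 0} \<in> sets borel" by simp
  have "level_set h d = {t \<in> space borel. t \<in> {0<..1} \<and> 0 < g t \<and> g t \<le> d}"
    by (auto simp: g_def level_set_def)
  then show "level_set h d \<in> sets borel" by simp
qed

locale rectifiable_curve =
  fixes v :: "real \<Rightarrow> point"
  assumes rect: "rectifiable v" and cont: "continuous_on {0..1} v"
begin

abbreviation "M \<equiv> length_measure v"

lemma clamped_mono: "x \<le> y \<Longrightarrow> arc_length v (max 0 (min 1 x)) \<le> arc_length v (max 0 (min 1 y))"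
  by (rule arc_length_mono[OF rect]) auto

lemma clamped_continuous: "continuous_on UNIV (\<lambda>t. arc_length v (max 0 (min 1 t)))"
  by (rule continuous_on_compose2[OF continuous_on_arc_length[OF rect cont]]) (auto intro!: continuous_intros)

lemma emeasure_Ioc:
  assumes "0 \<le> s" "s \<le> t" "t \<le> 1"
  shows "emeasure M {s<..t} = ennreal (arc_length v t - arc_length v s)"
proof -
  have "continuous (at_right a) (\<lambda>t. arc_length v (max 0 (min 1 t)))" for a
    using clamped_continuous by (simp add: continuous_on_eq_continuous_at continuous_at_imp_continuous_at_within)
  then have "emeasure M {s<..t} = ennreal (arc_length v (max 0 (min 1 t)) - arc_length v (max 0 (min 1 s)))"
    unfolding length_measure_def using assms by (intro emeasure_interval_measure_Ioc clamped_mono) auto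
  then show ?thesis using assms by simp
qed

lemma measure_Ioc:
  assumes "0 \<le> s" "s \<le> t" "t \<le> 1"
  shows "measure M {s<..t} = arc_length v t - arc_length v s"
  using emeasure_Ioc[OF assms] arc_length_mono[OF rect assms] by (simp add: measure_def)

lemma emeasure_Icc:
  assumes "0 \<le> s" "s \<le> t" "t \<le> 1"
  shows "emeasure M {s..t} = ennreal (arc_length v t - arc_length v s)"
proof -
  have "emeasure M {s..t} = ennreal (arc_length v (max 0 (min 1 t)) - arc_length v (max 0 (min 1 s)))"
    unfolding length_measure_def using assms clamped_continuous
    by (intro emeasure_interval_measure_Icc clamped_mono) auto
  then show ?thesis using assms by simp
qed

lemma emeasure_finite: "X \<subseteq> {0<..1} \<Longrightarrow> emeasure M X \<noteq> \<infinity>"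
  using emeasure_mono[of X "{0<..1}" M] emeasure_Ioc[of 0 1] by (auto simp: top_unique)

lemma measure_mono_unit: "X \<subseteq> Y \<Longrightarrow> Y \<subseteq> {0<..1} \<Longrightarrow> X \<in> sets borel \<Longrightarrow> Y \<in> sets borel \<Longrightarrow> measure M X \<le> measure M Y"
  by (rule measure_mono_fmeasurable) (auto intro!: fmeasurableI simp: less_top[symmetric] emeasure_finite[unfolded infinity_ennreal_def])

text \<open>Continuity from above of a finite measure along \<open>d = 1 / (n + 1)\<close>, where
  the level sets decrease to the empty set; monotonicity in \<open>d\<close> gives the remaining
  values.\<close>

lemma measure_level_set_small:
  assumes h: "continuous_on {0..1} h" and e: "e > 0"
  shows "\<forall>\<^sub>F d in at_right 0. measure M (level_set h d) < e"
proof -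
  let ?A = "\<lambda>n. level_set h (inverse (real (Suc n)))"
  have "(\<lambda>n. measure M (?A n)) \<longlonglongrightarrow> measure M (\<Inter>n. ?A n)"
  proof (rule Lim_measure_decseq)
    show "range ?A \<subseteq> sets M" using borel_measurable_sublevel(2)[OF h] by auto
    show "decseq ?A"
      unfolding decseq_def level_set_def
      by (auto intro: order_trans le_imp_inverse_le)
  qed (rule emeasure_finite[OF level_set_subset])
  moreover have "(\<Inter>n. ?A n) = {}"
  proof -
    have "\<exists>n. inverse (real (Suc n)) < h t" if "0 < h t" for t
      using reals_Archimedean[OF that] .
    then show ?thesis by (auto simp: level_set_def) (meson not_less)
  qed
  ultimately have "(\<lambda>n. measure M (?A n)) \<longlonglongrightarrow> 0" by simp
  then have "\<forall>\<^sub>F n in sequentially. measure M (?A n) < e"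
    using e by (rule order_tendstoD)
  then obtain n where "measure M (?A n) < e"
    using eventually_happens'[OF sequentially_bot] by blast
  have "measure M (level_set h d) < e" if "d < inverse (real (Suc n))" for d
  proof -
    have "level_set h d \<subseteq> ?A n"
      using that by (auto simp: level_set_def)
    then have "measure M (level_set h d) \<le> measure M (?A n)"
      by (rule measure_mono_unit[OF _ level_set_subset]) (rule borel_measurable_sublevel(2)[OF h])+
    then show ?thesis using \<open>measure M (?A n) < e\<close> by (rule order_le_less_trans)
  qed
  then show ?thesis
    unfolding eventually_at_right_field by (intro exI[of _ "inverse (real (Suc n))"]) auto
qed

lemma sum_measure_grid:
  assumes Z: "Z \<subseteq> {0<..1}" "Z \<in> sets borel"
  shows "(\<Sum>i=1..n. measure M ({(real i - 1) / real n<..real i / real n} \<inter> Z)) \<le> measure M Z"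
proof -
  let ?I = "\<lambda>i. {(real i - 1) / real n<..real i / real n} \<inter> Z"
  have disj: "?I i \<inter> ?I j = {}" if "i < j" "j \<le> n" for i j
  proof -
    have "real i / real n \<le> (real j - 1) / real n"
      using that by (intro divide_right_mono) auto
    then show ?thesis by auto
  qed
  have "(\<Sum>i=1..n. measure M (?I i)) = measure M (\<Union>i\<in>{1..n}. ?I i)"
  proof (rule measure_finite_Union[symmetric])
    show "disjoint_family_on ?I {1..n}"
      unfolding disjoint_family_on_def
    proof (intro ballI impI)
      fix i j assume "i \<in> {1..n}" "j \<in> {1..n}" "i \<noteq> j"
      then show "?I i \<inter> ?I j = {}"
        using disj[of i j] disj[of j i] by (cases "i < j") auto
    qed
    show "emeasure M (?I i) \<noteq> \<infinity>" for i
      by (rule emeasure_finite) (use Z in auto)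
  qed (use Z in auto)
  also have "\<dots> \<le> measure M Z"
    by (rule measure_mono_unit) (use Z in auto)
  finally show ?thesis .
qed

text \<open>Arc length is continuous, so single times have measure \<open>0\<close>. Hence it is
  enough that the open interval lies in \<open>Z\<close>, and an end point may be a contact
  time.\<close>

lemma d_inf_le_measure:
  assumes "0 \<le> s" "s \<le> t" "t \<le> 1" "{s<..<t} \<subseteq> Z" "Z \<in> sets borel" "Z \<subseteq> {0<..1}"
  shows "d_inf (v s) (v t) \<le> measure M Z"
proof -
  have "emeasure M {t} = 0"
    using emeasure_Icc[of t t] assms by simp
  moreover have "{s<..t} \<subseteq> Z \<union> {t}"
    using assms(4) by (fastforce simp: less_le)
  ultimately have "emeasure M {s<..t} \<le> emeasure M Z"
    using emeasure_mono[of "{s<..t}" "Z \<union> {t}" M] emeasure_Un_null_set[of Z M "{t}"] assms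
    by (auto simp: null_sets_def)
  then have "measure M {s<..t} \<le> measure M Z"
    unfolding measure_def using emeasure_finite[OF assms(6)] by (intro enn2real_mono) (auto simp: less_top)
  then show ?thesis
    using measure_Ioc[of s t] d_inf_le_arc_length[OF rect, of s t] assms by simp
qed

lemma emeasure_constant:
  assumes "{a..b} \<subseteq> {0..1}" "\<And>t. t \<in> {a..b} \<Longrightarrow> v t = c"
  shows "emeasure M {a..b} = 0"
proof (cases "a \<le> b")
  case True
  then show ?thesis
    using emeasure_Icc[of a b] arc_length_const[OF rect, of a b c] assms by auto
qed simp

end

text \<open>Up to the first time at which the two curves meet, they travel in the level set.\<close>

lemma min_chord_gap_le_measure:
  assumes v: "rectifiable_curve v" and u: "rectifiable_curve u"
    and st: "0 \<le> s" "s \<le> t" "t \<le> 1"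
    and gap: "\<And>x. x \<in> {s..t} \<Longrightarrow> d_inf (v x) (u x) \<le> d"
  shows "min (d_inf (v t) (v s)) (d_inf (v s) (u s))
    \<le> measure (length_measure v) ({s<..t} \<inter> level_set (\<lambda>x. d_inf (v x) (u x)) d)
      + measure (length_measure u) ({s<..t} \<inter> level_set (\<lambda>x. d_inf (v x) (u x)) d)"
proof -
  let ?h = "\<lambda>x. d_inf (v x) (u x)"
  let ?Z = "{s<..t} \<inter> level_set ?h d"
  interpret v: rectifiable_curve v by fact
  interpret u: rectifiable_curve u by fact
  have h: "continuous_on {0..1} ?h"
    by (intro continuous_intros v.cont u.cont)
  have Z: "?Z \<in> sets borel" "?Z \<subseteq> {0<..1}"
    using borel_measurable_sublevel(2)[OF h] level_set_subset by auto
  have Z_mem: "x \<in> ?Z" if "x \<in> {s<..t}" "?h x \<noteq> 0" for x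
    using that st gap[of x] d_inf_nonneg[of "v x" "u x"] by (auto simp: level_set_def)
  show ?thesis
  proof (cases "\<exists>x\<in>{s..t}. ?h x = 0")
    case False
    have "{s<..<t} \<subseteq> ?Z"
    proof
      fix y assume "y \<in> {s<..<t}"
      then show "y \<in> ?Z" using False by (intro Z_mem) auto
    qed
    from v.d_inf_le_measure[OF st this Z]
    have "d_inf (v t) (v s) \<le> measure v.M ?Z" by (simp add: d_inf_commute)
    moreover have "0 \<le> measure u.M ?Z" by simp
    ultimately show ?thesis by linarith
  next
    case True
    let ?T = "{x \<in> {s..t}. ?h x = 0}"
    have "closed ?T"
      using continuous_closed_preimage_constant[OF continuous_on_subset[OF h], of "{s..t}" 0] st by auto
    moreover have "bounded ?T" by (rule bounded_subset[of "{s..t}"]) auto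
    ultimately have "compact ?T" by (simp add: compact_eq_bounded_closed)
    then obtain x where x: "x \<in> ?T" "\<And>y. y \<in> ?T \<Longrightarrow> x \<le> y"
      using compact_attains_inf[of ?T] True by blast
    have sub: "{s<..<x} \<subseteq> ?Z"
    proof
      fix y assume "y \<in> {s<..<x}"
      then show "y \<in> ?Z" using x(1) x(2)[of y] by (intro Z_mem) auto
    qed
    have vx: "v x = u x"
      using x(1) dist_le_2_d_inf[of "v x" "u x"] by simp
    \<comment> \<open>The curves meet at time \<open>x\<close>, so together they have travelled at
      least the initial gap.\<close>
    have "?h s \<le> d_inf (v s) (v x) + d_inf (u s) (u x)"
      using d_inf_triangle[of "v s" "u s" "v x"] by (simp add: vx d_inf_commute)
    also have "\<dots> \<le> measure v.M ?Z + measure u.M ?Z"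
      using x(1) st sub Z by (intro add_mono v.d_inf_le_measure u.d_inf_le_measure) auto
    finally show ?thesis by linarith
  qed
qed


subsection \<open>Vines\<close>

text \<open>A common form of the four types: the vine rests during each of at most two intervals
  that make up its time on the diagonal. Either interval may be empty, and they may overlap.\<close>

lemma vine_constant_on_diagonal:
  assumes "vine v"
  obtains a b c d p q where "{t \<in> {0..1}. v t \<in> diagonal} = {a..b} \<union> {c..d}"
    "\<forall>t\<in>{a..b}. v t = p" "\<forall>t\<in>{c..d}. v t = q"
proof -
  have cont: "continuous_on {0..1} v" using assms by (simp add: vine_def)
  have on_diag: "{t \<in> {0..1}. v t \<in> diagonal} = {t \<in> {0..1}. v t \<in> v ` {0..1} \<inter> diagonal}"
    by blast
  consider "vine_type1 v" | x a b where "v ` {0..1} \<inter> diagonal = {x}" "{t \<in> {0..1}. v t = x} = {a..b}"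
    | "vine_type4 v"
    using assms unfolding vine_def vine_type2_def vine_type3_def by blast
  then show ?thesis
  proof cases
    case 1
    \<comment> \<open>\<open>{1..0}\<close> is empty and stands in for a missing interval.\<close>
    then have "{t \<in> {0..1}. v t \<in> diagonal} = {1..0} \<union> {1..0}"
      unfolding on_diag vine_type1_def by simp
    then show ?thesis by (rule that) simp_all
  next
    case (2 x a b)
    have "{t \<in> {0..1}. v t \<in> diagonal} = {a..b} \<union> {1..0}"
      unfolding on_diag 2(1) 2(2)[symmetric] by simp
    then show ?thesis
    proof (rule that)
      show "\<forall>t\<in>{a..b}. v t = x" unfolding 2(2)[symmetric] by simp
    qed simp
  next
    case 3
    then obtain x y a b c d where xy: "v ` {0..1} \<inter> diagonal = {x, y}"
      and abcd: "{t \<in> {0..1}. v t = x} \<union> {t \<in> {0..1}. v t = y} = {a..b} \<union> {c..d}"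
      unfolding vine_type4_def by blast
    \<comment> \<open>Type 4 does not say which of \<open>x\<close> and \<open>y\<close> is taken on
      which interval. On each of them the image is connected and contained in \<open>{x, y}\<close>,
      hence a single point if nonempty.\<close>
    have const: "\<exists>p. \<forall>t\<in>{l..r}. v t = p" if "{l..r} \<subseteq> {a..b} \<union> {c..d}" for l r
    proof -
      have sub: "{l..r} \<subseteq> {0..1}" "v ` {l..r} \<subseteq> {x, y}"
        using that unfolding abcd[symmetric] by blast+
      have "connected (v ` {l..r})"
        by (intro connected_continuous_image continuous_on_subset[OF cont] sub) auto
      moreover have "finite (v ` {l..r})"
        using sub(2) by (rule finite_subset) simp
      ultimately have "v ` {l..r} = {} \<or> (\<exists>p. v ` {l..r} = {p})"
        using connected_finite_iff_sing by blast
      then show ?thesis by blast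
    qed
    have "{t \<in> {0..1}. v t \<in> diagonal} = {a..b} \<union> {c..d}"
      unfolding abcd[symmetric] on_diag xy by blast
    moreover obtain p q where "\<forall>t\<in>{a..b}. v t = p" "\<forall>t\<in>{c..d}. v t = q"
      using const[OF Un_upper1] const[OF Un_upper2] by blast
    ultimately show ?thesis using that by blast
  qed
qed

lemma vine_rectifiable_curve: "vine v \<Longrightarrow> rectifiable_curve v"
  by (simp add: vine_def rectifiable_curve_def)

section \<open>Distance to the diagonal and motion near it\<close>

lemma abs_fst_le_d_inf: "\<bar>fst p - fst q\<bar> \<le> d_inf p q"
  by (simp add: d_inf_eq_max)

lemma abs_snd_le_d_inf: "\<bar>snd p - snd q\<bar> \<le> d_inf p q"
  by (simp add: d_inf_eq_max)

text \<open>On the half plane this is twice the sup distance to the diagonal.\<close>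

definition diagonal_gap :: "point \<Rightarrow> real" where
  "diagonal_gap p = snd p - fst p"

lemma continuous_on_diagonal_gap [continuous_intros]:
  "continuous_on S f \<Longrightarrow> continuous_on S (\<lambda>x. diagonal_gap (f x))"
  unfolding diagonal_gap_def by (intro continuous_intros)

lemma diagonal_gap_eq_0_iff: "diagonal_gap p = 0 \<longleftrightarrow> p \<in> diagonal"
  by (cases p) (auto simp: diagonal_gap_def diagonal_def)

lemma diagonal_gap_nonneg: "p \<in> half_plane \<Longrightarrow> 0 \<le> diagonal_gap p"
  by (cases p) (auto simp: diagonal_gap_def half_plane_def)

lemma diagonal_gap_lipschitz: "\<bar>diagonal_gap p - diagonal_gap q\<bar> \<le> 2 * d_inf p q"
  using abs_fst_le_d_inf[of p q] abs_snd_le_d_inf[of p q] unfolding diagonal_gap_def by linarith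


text \<open>The vine rests on the intervals that make up its time on the diagonal, so this time has
  length measure \<open>0\<close>. All motion is then charged to times of positive gap, that is, to
  the level set.\<close>

lemma vine_chord_le_measure:
  assumes v: "vine v" and half: "v ` {0..1} \<subseteq> half_plane"
    and st: "0 \<le> s" "s \<le> t" "t \<le> 1"
    and gap: "\<And>x. x \<in> {s..t} \<Longrightarrow> diagonal_gap (v x) \<le> d"
  shows "d_inf (v t) (v s)
    \<le> measure (length_measure v) ({s<..t} \<inter> level_set (\<lambda>x. diagonal_gap (v x)) d)"
proof -
  let ?h = "\<lambda>x. diagonal_gap (v x)"
  let ?Z = "{s<..t} \<inter> level_set ?h d" and ?N = "{x \<in> {0<..1}. ?h x = 0}"
  interpret rectifiable_curve v using v by (rule vine_rectifiable_curve)
  have h: "continuous_on {0..1} ?h"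
    by (intro continuous_intros cont)
  have Z: "?Z \<in> sets borel" "?Z \<subseteq> {0<..1}"
    using borel_measurable_sublevel(2)[OF h] level_set_subset by auto
  have N: "?N \<in> sets borel"
    by (rule borel_measurable_sublevel(1)[OF h])
  obtain a b c d' p q where abcd: "{t \<in> {0..1}. v t \<in> diagonal} = {a..b} \<union> {c..d'}"
    and const: "\<forall>t\<in>{a..b}. v t = p" "\<forall>t\<in>{c..d'}. v t = q"
    by (rule vine_constant_on_diagonal[OF v])
  have sub: "{a..b} \<subseteq> {0..1}" "{c..d'} \<subseteq> {0..1}"
    using abcd by blast+
  have null_ivls: "{a..b} \<union> {c..d'} \<in> null_sets M"
    using emeasure_constant[OF sub(1)] emeasure_constant[OF sub(2)] const
    by (intro null_sets.Un null_setsI) auto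
  have "?N \<subseteq> {a..b} \<union> {c..d'}"
    unfolding abcd[symmetric] by (auto simp: diagonal_gap_eq_0_iff)
  then have null: "?N \<in> null_sets M"
    by (rule null_sets_subset[OF null_ivls, rotated]) (simp only: N sets_length_measure)
  have "{s<..<t} \<subseteq> ?Z \<union> ?N"
  proof
    fix x assume x: "x \<in> {s<..<t}"
    then have "0 \<le> ?h x"
      using half st by (intro diagonal_gap_nonneg) auto
    then show "x \<in> ?Z \<union> ?N"
      using x st gap[of x] by (auto simp: level_set_def)
  qed
  then have "d_inf (v s) (v t) \<le> measure M (?Z \<union> ?N)"
    by (rule d_inf_le_measure[OF st]) (use Z N in auto)
  also have "\<dots> = measure M ?Z"
    using Z null by (simp add: measure_Un_null_set)
  finally show ?thesis by (simp add: d_inf_commute)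
qed


subsection \<open>Partial bijections between indexed diagrams\<close>

lemma sum_mset_map_nonneg:
  fixes f :: "'a \<Rightarrow> 'b::ordered_comm_monoid_add"
  assumes "\<And>x. x \<in># A \<Longrightarrow> 0 \<le> f x"
  shows "0 \<le> (\<Sum>x\<in>#A. f x)"
  using assms by (induction A) auto

text \<open>All multiplicities in \<open>mset_set J\<close> are at most \<open>1\<close>, so
  splitting it as a multiset amounts to splitting \<open>J\<close> as a set.\<close>

lemma mset_set_eq_plusD:
  assumes "finite J" "mset_set J = A + B"
  shows "set_mset A \<subseteq> J" "A = mset_set (set_mset A)" "B = mset_set (J - set_mset A)"
proof -
  show sub: "set_mset A \<subseteq> J"
    using assms by (metis finite_set_mset_mset_set set_mset_union sup_ge1)
  have "count A x \<le> 1" for x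
    using arg_cong[OF assms(2), of "\<lambda>M. count M x"] by (auto simp: count_mset_set' split: if_splits)
  then show A: "A = mset_set (set_mset A)"
    by (intro multiset_eqI) (auto simp: count_mset_set' not_in_iff intro: antisym)
  have "B = mset_set J - mset_set (set_mset A)"
    using assms(2) A by (metis add_diff_cancel_left')
  then show "B = mset_set (J - set_mset A)"
    using sub assms(1) by (simp add: mset_set_Diff finite_subset)
qed

text \<open>The index set is used up one element at a time. Since \<open>f\<close> may take a value
  repeatedly, the partner is attached to the index and not to the point.\<close>

lemma image_mset_fst_eq_indexed:
  assumes "finite S" "image_mset fst M = image_mset f (mset_set S)"
  shows "\<exists>g. M = image_mset (\<lambda>j. (f j, g j)) (mset_set S)"
  using assms
proof (induction S arbitrary: M rule: finite_induct)
  case (insert x S)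
  then obtain a M' where a: "M = add_mset a M'" "fst a = f x" "image_mset fst M' = image_mset f (mset_set S)"
    using msed_map_invR[of fst M "f x" "image_mset f (mset_set S)"] by auto
  then obtain g where g: "M' = image_mset (\<lambda>j. (f j, g j)) (mset_set S)"
    using insert.IH by blast
  have "M' = image_mset (\<lambda>j. (f j, (g(x := snd a)) j)) (mset_set S)"
    unfolding g using insert.hyps by (intro image_mset_cong) auto
  then have "M = image_mset (\<lambda>j. (f j, (g(x := snd a)) j)) (mset_set (insert x S))"
    using a insert.hyps by (cases a) auto
  then show ?case by blast
qed simp

text \<open>Turns a matching of multisets into a partial function on indices, so that a matched
  point can be traced to its vine: \<open>S\<close> holds the matched indices and \<open>g\<close>
  their partners.\<close>

lemma partial_bijection_indexed:
  assumes J: "finite J" and M: "partial_bijection (image_mset f (mset_set J)) Q M"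
  obtains S g where "S \<subseteq> J" "M = image_mset (\<lambda>j. (f j, g j)) (mset_set S)"
    "image_mset f (mset_set J) - image_mset fst M = image_mset f (mset_set (J - S))"
    "\<forall>j\<in>S. g j \<in># Q"
proof -
  let ?P = "image_mset f (mset_set J)"
  have "?P = image_mset fst M + (?P - image_mset fst M)"
    using M by (simp add: partial_bijection_def)
  then obtain A B where AB: "mset_set J = A + B" "image_mset fst M = image_mset f A"
    "?P - image_mset fst M = image_mset f B"
    using image_mset_eq_plusD by metis
  let ?S = "set_mset A"
  obtain g where g: "M = image_mset (\<lambda>j. (f j, g j)) (mset_set ?S)"
    using image_mset_fst_eq_indexed[of ?S M f] AB mset_set_eq_plusD[OF J AB(1)] by auto
  show ?thesis
  proof (rule that[of ?S g])
    show "\<forall>j\<in>?S. g j \<in># Q"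
    proof
      fix j assume "j \<in> ?S"
      then have "g j \<in># image_mset snd M"
        unfolding g by (simp add: image_image)
      then show "g j \<in># Q" using M unfolding partial_bijection_def by (blast dest: mset_subset_eqD)
    qed
  qed (use g AB mset_set_eq_plusD[OF J AB(1)] in auto)
qed


subsection \<open>Weighted costs\<close>

lemma diagonal_subset_half_plane: "diagonal \<subseteq> half_plane"
  by (auto simp: diagonal_def half_plane_def)

lemma weighted_d_nonneg:
  "weighting_function w \<Longrightarrow> p \<in> half_plane \<Longrightarrow> q \<in> half_plane \<Longrightarrow> 0 \<le> weighted_d w p q"
  by (simp add: weighted_d_def d_inf_nonneg weighting_function_nonneg)

lemma weighted_d_ge:
  assumes "weighting_function w" "p \<in> half_plane" "q \<in> half_plane"
  shows "d_inf p q * w p / 2 \<le> weighted_d w p q"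
  using mult_nonneg_nonneg[OF d_inf_nonneg weighting_function_nonneg[OF assms(1,3)], of p q]
  by (simp add: weighted_d_def field_simps)

lemma weighted_d_le:
  assumes "w p \<le> B" "w q \<le> B"
  shows "weighted_d w p q \<le> B * d_inf p q"
  using mult_left_mono[OF _ d_inf_nonneg, of "(w p + w q) / 2" B p q] assms
  by (simp add: weighted_d_def mult.commute)

text \<open>One factor \<open>1 / 2\<close> comes from
  \<open>diagonal_gap p \<le> 2 * d_inf p q\<close>, the other from keeping only \<open>w p\<close>
  in the mean of the two weights.\<close>

lemma weighted_d_diag_ge:
  assumes w: "weighting_function w" and p: "p \<in> half_plane"
  shows "diagonal_gap p * w p / 4 \<le> weighted_d_diag w p"
  unfolding weighted_d_diag_def
proof (rule cINF_greatest)
  show "diagonal \<noteq> {}" by (auto simp: diagonal_def)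
  fix q assume q: "q \<in> diagonal"
  then have "q \<in> half_plane" using diagonal_subset_half_plane by blast
  have "diagonal_gap p \<le> 2 * d_inf p q"
    using diagonal_gap_lipschitz[of p q] diagonal_gap_eq_0_iff[of q] q by simp
  then have "diagonal_gap p * w p \<le> 2 * d_inf p q * w p"
    by (rule mult_right_mono) (rule weighting_function_nonneg[OF w p])
  then show "diagonal_gap p * w p / 4 \<le> weighted_d w p q"
    using weighted_d_ge[OF w p \<open>q \<in> half_plane\<close>] by simp
qed

lemma weighted_d_diag_nonneg: "weighting_function w \<Longrightarrow> p \<in> half_plane \<Longrightarrow> 0 \<le> weighted_d_diag w p"
  by (rule order_trans[OF _ weighted_d_diag_ge])
    (auto simp: diagonal_gap_nonneg weighting_function_nonneg)

text \<open>Pairing equal indices leaves no point over, so only the matched terms of the cost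
  remain.\<close>

lemma weighted_wasserstein_le_indexed:
  assumes "finite J"
  shows "weighted_wasserstein w (image_mset f (mset_set J)) (image_mset g (mset_set J))
    \<le> (\<Sum>j\<in>J. weighted_d w (f j) (g j))"
proof -
  let ?P = "image_mset f (mset_set J)" and ?Q = "image_mset g (mset_set J)"
  let ?M = "image_mset (\<lambda>j. (f j, g j)) (mset_set J)"
  have M: "image_mset fst ?M = ?P" "image_mset snd ?M = ?Q"
    by (simp_all add: image_mset.compositionality comp_def)
  have "weighted_wasserstein w ?P ?Q \<le> weighted_cost w ?P ?Q ?M"
    unfolding weighted_wasserstein_def
    by (rule Min_le) (use finite_partial_bijections[of ?P ?Q] M in \<open>auto simp: partial_bijection_def[of _ _ ?M]\<close>)
  also have "\<dots> = (\<Sum>j\<in>J. weighted_d w (f j) (g j))"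
    unfolding weighted_cost_def M
    by (simp add: image_mset.compositionality comp_def sum_unfold_sum_mset)
  finally show ?thesis .
qed

text \<open>The minimum is attained, since there are finitely many partial bijections and the empty
  one is among them. The inequality arises by dropping the nonnegative cost of the unmatched points
  of \<open>Q\<close>.\<close>

lemma weighted_wasserstein_indexed_matching:
  assumes w: "weighting_function w" and J: "finite J" and Q: "set_mset Q \<subseteq> half_plane"
  obtains S g where "S \<subseteq> J" "\<forall>j\<in>S. g j \<in># Q"
    "(\<Sum>j\<in>J. if j \<in> S then weighted_d w (f j) (g j) else weighted_d_diag w (f j))
      \<le> weighted_wasserstein w (image_mset f (mset_set J)) Q"
proof -
  let ?P = "image_mset f (mset_set J)"
  have "weighted_wasserstein w ?P Q \<in> weighted_cost w ?P Q ` {M. partial_bijection ?P Q M}"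
    unfolding weighted_wasserstein_def
    by (rule Min_in) (use finite_partial_bijections partial_bijection_empty in blast)+
  then obtain M where M: "partial_bijection ?P Q M" "weighted_wasserstein w ?P Q = weighted_cost w ?P Q M"
    by blast
  obtain S g where S: "S \<subseteq> J" and g: "M = image_mset (\<lambda>j. (f j, g j)) (mset_set S)"
    and rest: "?P - image_mset fst M = image_mset f (mset_set (J - S))"
    and gQ: "\<forall>j\<in>S. g j \<in># Q"
    by (rule partial_bijection_indexed[OF J M(1)])
  have "(\<Sum>j\<in>J. if j \<in> S then weighted_d w (f j) (g j) else weighted_d_diag w (f j))
      = (\<Sum>j\<in>S. weighted_d w (f j) (g j)) + (\<Sum>j\<in>J - S. weighted_d_diag w (f j))"
    using sum.subset_diff[OF S J, of "\<lambda>j. if j \<in> S then weighted_d w (f j) (g j) else weighted_d_diag w (f j)"]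
    by (simp add: add.commute)
  also have "\<dots> = (\<Sum>(\<alpha>, \<beta>)\<in>#M. weighted_d w \<alpha> \<beta>) + (\<Sum>\<alpha>\<in>#?P - image_mset fst M. weighted_d_diag w \<alpha>)"
    unfolding rest unfolding g
    by (simp add: image_mset.compositionality comp_def sum_unfold_sum_mset)
  also have "\<dots> \<le> weighted_wasserstein w ?P Q"
  proof -
    have "0 \<le> (\<Sum>\<beta>\<in>#Q - image_mset snd M. weighted_d_diag w \<beta>)"
    proof (rule sum_mset_map_nonneg)
      show "0 \<le> weighted_d_diag w \<beta>" if "\<beta> \<in># Q - image_mset snd M" for \<beta>
        using Q in_diffD[OF that] by (intro weighted_d_diag_nonneg[OF w]) auto
    qed
    then show ?thesis unfolding M(2) weighted_cost_def by simp
  qed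
  finally show ?thesis by (rule that[OF S gQ])
qed


subsection \<open>Comparing an optimal matching with the matching along vines\<close>

text \<open>Here \<open>p\<close> and \<open>p'\<close> are a vine at the end and at the start of a
  step, and \<open>q\<close> is the partner of \<open>p\<close> at the start. If the chord is at
  most the gap from \<open>p'\<close> to \<open>q\<close>, the last term pays for the whole chord.
  Otherwise, replacing \<open>q\<close> by \<open>p'\<close> changes the distance by at most the gap
  and the weight by at most \<open>e\<close>.\<close>

lemma matched_cost_ge:
  assumes w: "weighting_function w"
    and half: "p \<in> half_plane" "p' \<in> half_plane" "q \<in> half_plane"
    and B: "w p \<le> B" "w p' \<le> B" "w q \<le> B" and e: "\<bar>w q - w p'\<bar> \<le> e"
  shows "weighted_d w p p' \<le> weighted_d w p q + e * d_inf p p' + B * min (d_inf p p') (d_inf p' q)"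
proof -
  let ?a = "d_inf p p'" and ?h = "d_inf p' q"
  have nn: "0 \<le> ?a" "0 \<le> ?h" "0 \<le> w p" "0 \<le> w p'" "0 \<le> w q" "0 \<le> e"
    using weighting_function_nonneg[OF w] half e by (auto simp: d_inf_nonneg)
  show ?thesis
  proof (cases "?a \<le> ?h")
    case True
    then show ?thesis
      using weighted_d_le[where w = w and p = p and q = p', OF B(1,2)]
        weighted_d_nonneg[OF w half(1,3)] mult_nonneg_nonneg[OF nn(6,1)] by simp
  next
    case False
    have "?a - ?h \<le> d_inf p q"
      using d_inf_triangle[of p p' q] by (simp add: d_inf_commute)
    then have 1: "(?a - ?h) * ((w p + w q) / 2) \<le> weighted_d w p q"
      unfolding weighted_d_def using nn by (intro mult_right_mono) auto
    have 2: "?h * ((w p + w q) / 2) \<le> B * ?h"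
      using mult_left_mono[of "(w p + w q) / 2" B ?h] B nn by (simp add: mult.commute)
    have 3: "?a * ((w p' - w q) / 2) \<le> e * ?a"
      using mult_left_mono[of "(w p' - w q) / 2" e ?a] e nn by (simp add: mult.commute)
    \<comment> \<open>The three terms are paid for by the cost of the matched pair, by the gap and
      by the change of weight.\<close>
    have "weighted_d w p p' = (?a - ?h) * ((w p + w q) / 2) + ?h * ((w p + w q) / 2) + ?a * ((w p' - w q) / 2)"
      by (simp add: weighted_d_def field_simps)
    then show ?thesis using 1 2 3 False by simp
  qed
qed

section \<open>A finite family of vines and the losses in one grid step\<close>

locale weighted_vines =
  fixes w :: "point \<Rightarrow> real" and J :: "'i set" and V :: "'i \<Rightarrow> real \<Rightarrow> point"
  assumes w: "weighting_function w" and J: "finite J"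
    and vine: "\<And>j. j \<in> J \<Longrightarrow> vine (V j)"
    and half: "\<And>j t. j \<in> J \<Longrightarrow> t \<in> {0..1} \<Longrightarrow> V j t \<in> half_plane"
begin

abbreviation diagram_at :: "real \<Rightarrow> diagram" where
  "diagram_at t \<equiv> image_mset (\<lambda>j. V j t) (mset_set J)"

abbreviation len :: "'i \<Rightarrow> real set \<Rightarrow> real" where
  "len j \<equiv> measure (length_measure (V j))"

abbreviation near_diagonal :: "'i \<Rightarrow> real \<Rightarrow> real set" where
  "near_diagonal j \<equiv> level_set (\<lambda>x. diagonal_gap (V j x))"

abbreviation near_vine :: "'i \<Rightarrow> 'i \<Rightarrow> real \<Rightarrow> real set" where
  "near_vine j k \<equiv> level_set (\<lambda>x. d_inf (V j x) (V k x))"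

text \<open>The losses of one vine in a step: motion near the diagonal, the change of weight on
  passing to the partner, and motion close to the partner. Summing over all \<open>k\<close> makes
  the bound independent of the partner that an optimal matching selects.\<close>

definition step_error :: "real \<Rightarrow> real \<Rightarrow> real \<Rightarrow> real \<Rightarrow> 'i \<Rightarrow> real set \<Rightarrow> real" where
  "step_error B e \<delta> \<delta>' j I = B * len j (I \<inter> near_diagonal j \<delta>) + e * len j I
     + (\<Sum>k\<in>J. B * (len j (I \<inter> near_vine j k \<delta>') + len k (I \<inter> near_vine j k \<delta>')))"

lemma image_half: "j \<in> J \<Longrightarrow> V j ` {0..1} \<subseteq> half_plane"
  using half by blast

lemma curve: "j \<in> J \<Longrightarrow> rectifiable_curve (V j)"
  using vine by (rule vine_rectifiable_curve)

text \<open>\<open>\<omega>\<close> bounds the motion of a vine during the step, \<open>c\<close>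
  the weight away from the diagonal from below, and \<open>\<eta>\<close> the cost of matching along
  the vines. The conditions in \<open>small\<close> force an optimal matching to pair each vine away
  from the diagonal with one that stays within \<open>\<delta>'\<close> of it.\<close>

lemma vine_step:
  assumes st: "0 \<le> s" "s \<le> t" "t \<le> 1"
    and B: "0 \<le> B" "\<And>j x. j \<in> J \<Longrightarrow> x \<in> {0..1} \<Longrightarrow> w (V j x) \<le> B"
    and e: "0 \<le> e" "\<And>p q. p \<in> half_plane \<Longrightarrow> q \<in> half_plane \<Longrightarrow> d_inf p q \<le> \<delta>' \<Longrightarrow> \<bar>w p - w q\<bar> \<le> e"
    and osc: "\<And>j x y. j \<in> J \<Longrightarrow> x \<in> {s..t} \<Longrightarrow> y \<in> {s..t} \<Longrightarrow> d_inf (V j x) (V j y) \<le> \<omega>"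
    and c: "0 < c" "\<And>j x. j \<in> J \<Longrightarrow> x \<in> {0..1} \<Longrightarrow> \<delta> / 2 \<le> diagonal_gap (V j x) \<Longrightarrow> c \<le> w (V j x)"
    and total: "(\<Sum>j\<in>J. weighted_d w (V j t) (V j s)) \<le> \<eta>"
    and small: "0 < \<delta>" "\<eta> < \<delta> * c / 8" "2 * \<eta> / c + 3 * \<omega> \<le> \<delta>'" "4 * \<omega> \<le> \<delta>"
  shows "(\<Sum>j\<in>J. weighted_d w (V j t) (V j s))
    \<le> weighted_wasserstein w (diagram_at t) (diagram_at s) + (\<Sum>j\<in>J. step_error B e \<delta> \<delta>' j {s<..t})"
proof -
  have s01: "s \<in> {0..1}" and t01: "t \<in> {0..1}" and sub: "{s..t} \<subseteq> {0..1}"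
    and s_st: "s \<in> {s..t}" and t_st: "t \<in> {s..t}" using st by auto
  have half_s: "set_mset (diagram_at s) \<subseteq> half_plane"
    using half[OF _ s01] J by auto
  obtain S g where S: "S \<subseteq> J" and g: "\<forall>j\<in>S. g j \<in># diagram_at s"
    and cost: "(\<Sum>j\<in>J. if j \<in> S then weighted_d w (V j t) (g j) else weighted_d_diag w (V j t))
      \<le> weighted_wasserstein w (diagram_at t) (diagram_at s)"
    by (rule weighted_wasserstein_indexed_matching[OF w J half_s])
  define E where "E j = (if j \<in> S then weighted_d w (V j t) (g j) else weighted_d_diag w (V j t))" for j
  have g_half: "g j \<in> half_plane" if "j \<in> S" for j
    using g half_s that by blast
  have E_nonneg: "0 \<le> E j" if "j \<in> J" for j
    using that g_half half[OF that t01] weighted_d_nonneg[OF w] weighted_d_diag_nonneg[OF w] by (auto simp: E_def)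
  \<comment> \<open>The optimal cost is at most that of matching along the vines, and no single
    nonnegative term exceeds the sum.\<close>
  have E_le: "E j \<le> \<eta>" if "j \<in> J" for j
  proof -
    have "E j \<le> (\<Sum>j\<in>J. E j)"
      using that J E_nonneg by (intro member_le_sum) auto
    also have "\<dots> \<le> (\<Sum>j\<in>J. weighted_d w (V j t) (V j s))"
      using cost weighted_wasserstein_le_indexed[OF J] unfolding E_def by (rule order_trans)
    finally show ?thesis using total by simp
  qed
  have "weighted_d w (V j t) (V j s) \<le> E j + step_error B e \<delta> \<delta>' j {s<..t}" if j: "j \<in> J" for j
  proof -
    let ?a = "d_inf (V j t) (V j s)"
    have sum_nonneg: "0 \<le> (\<Sum>k\<in>J. B * (len j ({s<..t} \<inter> near_vine j k \<delta>') + len k ({s<..t} \<inter> near_vine j k \<delta>')))"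
      using B(1) by (intro sum_nonneg mult_nonneg_nonneg add_nonneg_nonneg) auto
    have a_le: "?a \<le> len j {s<..t}"
    proof -
      have "{s<..<t} \<subseteq> {s<..t}" "{s<..t} \<subseteq> {0<..1}" using st by auto
      then show ?thesis
        using rectifiable_curve.d_inf_le_measure[OF curve[OF j] st, of "{s<..t}"] by (simp add: d_inf_commute)
    qed
    show ?thesis
    proof (cases "diagonal_gap (V j t) < \<delta> / 2")
      case True
      \<comment> \<open>The gap starts below \<open>\<delta> / 2\<close> and changes by at most
        \<open>2 * \<omega> \<le> \<delta> / 2\<close>.\<close>
      have "diagonal_gap (V j x) \<le> \<delta>" if x: "x \<in> {s..t}" for x
        using diagonal_gap_lipschitz[of "V j x" "V j t"] osc[OF j x t_st] True small by linarith
      then have "?a \<le> len j ({s<..t} \<inter> near_diagonal j \<delta>)"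
        by (rule vine_chord_le_measure[OF vine[OF j] image_half[OF j] st])
      then have "B * ?a \<le> B * len j ({s<..t} \<inter> near_diagonal j \<delta>)"
        using B(1) by (rule mult_left_mono)
      moreover have "weighted_d w (V j t) (V j s) \<le> B * ?a"
        using B(2)[OF j] s01 t01 by (intro weighted_d_le) auto
      moreover have "0 \<le> e * len j {s<..t}" using e(1) by simp
      ultimately show ?thesis
        using sum_nonneg E_nonneg[OF j] unfolding step_error_def by linarith
    next
      case False
      then have cw: "c \<le> w (V j t)" using c(2)[OF j t01] by simp
      \<comment> \<open>Leaving \<open>V j\<close> unmatched would cost at least
        \<open>(\<delta> / 2) * c / 4 = \<delta> * c / 8\<close>, which exceeds
        \<open>\<eta>\<close>.\<close>
      have "j \<in> S"
      proof (rule ccontr)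
        assume "j \<notin> S"
        then have "diagonal_gap (V j t) * w (V j t) / 4 \<le> E j"
          using weighted_d_diag_ge[OF w half[OF j t01]] by (simp add: E_def)
        moreover have "\<delta> / 2 * c \<le> diagonal_gap (V j t) * w (V j t)"
          using False cw c(1) small(1) by (intro mult_mono) auto
        ultimately show False using E_le[OF j] small(2) by linarith
      qed
      then obtain k where k: "k \<in> J" "g j = V k s" using g J by auto
      then have Ej: "E j = weighted_d w (V j t) (V k s)" using \<open>j \<in> S\<close> by (simp add: E_def)
      let ?b = "d_inf (V j t) (V k s)" and ?h = "d_inf (V j s) (V k s)"
      \<comment> \<open>Keeping only the weight of \<open>V j t\<close>, which is at least
        \<open>c\<close>, turns the bound on the cost into a bound on the distance to the
        partner.\<close>
      have "?b * c / 2 \<le> \<eta>"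
      proof -
        have "?b * c \<le> ?b * w (V j t)" using cw by (rule mult_left_mono) (rule d_inf_nonneg)
        then show ?thesis
          using weighted_d_ge[OF w half[OF j t01] half[OF k(1) s01]] E_le[OF j] by (simp add: Ej)
      qed
      then have b: "?b \<le> 2 * \<eta> / c" using c(1) by (simp add: field_simps)
      \<comment> \<open>The detour through \<open>V j t\<close> and \<open>V k s\<close> gives
        \<open>2 * \<eta> / c + 2 * \<omega>\<close>; \<open>osc\<close> at the pair
        \<open>s\<close>, \<open>s\<close> yields \<open>0 \<le> \<omega>\<close>.\<close>
      have gap: "d_inf (V j x) (V k x) \<le> \<delta>'" if x: "x \<in> {s..t}" for x
        using d_inf_triangle[of "V j x" "V k x" "V j t"] d_inf_triangle[of "V j t" "V k x" "V k s"]
          osc[OF j x t_st] osc[OF k(1) s_st x] osc[OF j s_st s_st] b small(3)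
        by (simp add: d_inf_nonneg)
      have "\<bar>w (V k s) - w (V j s)\<bar> \<le> e"
        using e(2)[OF half[OF k(1) s01] half[OF j s01]] gap[OF s_st] by (simp add: d_inf_commute)
      then have "weighted_d w (V j t) (V j s) \<le> E j + e * ?a + B * min ?a ?h"
        unfolding Ej using j k s01 t01 B(2) by (intro matched_cost_ge[OF w] half) auto
      moreover have "e * ?a \<le> e * len j {s<..t}" using a_le e(1) by (rule mult_left_mono)
      moreover have "B * min ?a ?h
        \<le> (\<Sum>k\<in>J. B * (len j ({s<..t} \<inter> near_vine j k \<delta>') + len k ({s<..t} \<inter> near_vine j k \<delta>')))"
      proof -
        have "B * min ?a ?h \<le> B * (len j ({s<..t} \<inter> near_vine j k \<delta>') + len k ({s<..t} \<inter> near_vine j k \<delta>'))"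
          using min_chord_gap_le_measure[OF curve[OF j] curve[OF k(1)] st gap] B(1) by (rule mult_left_mono)
        also have "\<dots> \<le> (\<Sum>k\<in>J. B * (len j ({s<..t} \<inter> near_vine j k \<delta>') + len k ({s<..t} \<inter> near_vine j k \<delta>')))"
          using k(1) J B(1) by (intro member_le_sum[where f = "\<lambda>k. B * (len j ({s<..t} \<inter> near_vine j k \<delta>') + len k ({s<..t} \<inter> near_vine j k \<delta>'))"]) auto
        finally show ?thesis .
      qed
      moreover have "0 \<le> B * len j ({s<..t} \<inter> near_diagonal j \<delta>)" using B(1) by simp
      ultimately show ?thesis unfolding step_error_def by linarith
    qed
  qed
  then have "(\<Sum>j\<in>J. weighted_d w (V j t) (V j s)) \<le> (\<Sum>j\<in>J. E j) + (\<Sum>j\<in>J. step_error B e \<delta> \<delta>' j {s<..t})"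
    unfolding sum.distrib[symmetric] by (rule sum_mono)
  then show ?thesis using cost unfolding E_def by linarith
qed

text \<open>Each term is a constant times a length measure, and the grid intervals are
  disjoint.\<close>

lemma sum_step_error_le:
  assumes "0 \<le> B" "0 \<le> e" "j \<in> J" "n > 0"
  shows "(\<Sum>i=1..n. step_error B e \<delta> \<delta>' j {(real i - 1) / real n<..real i / real n})
    \<le> step_error B e \<delta> \<delta>' j {0<..1}"
proof -
  let ?I = "\<lambda>i. {(real i - 1) / real n<..real i / real n}"
  have bound: "(\<Sum>i=1..n. len k (?I i \<inter> Z)) \<le> len k ({0<..1} \<inter> Z)"
    if "k \<in> J" "Z \<in> sets borel" "Z \<subseteq> {0<..1}" for k Z
    using rectifiable_curve.sum_measure_grid[OF curve[OF that(1)] that(3,2)] that(3)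
    by (simp add: Int_absorb1)
  have near: "near_diagonal j \<delta> \<in> sets borel" "k \<in> J \<Longrightarrow> near_vine j k \<delta>' \<in> sets borel" for k
    using rectifiable_curve.cont[OF curve] assms(3)
    by (auto intro!: borel_measurable_sublevel continuous_intros)
  have "?I i \<subseteq> {0<..1}" if "i \<in> {1..n}" for i
    using grid_in_unit[OF that] by auto
  then have I: "(\<Sum>i=1..n. len j (?I i)) = (\<Sum>i=1..n. len j (?I i \<inter> {0<..1}))"
    by (intro sum.cong) (simp_all add: Int_absorb2)
  have "(\<Sum>i=1..n. step_error B e \<delta> \<delta>' j (?I i))
    = B * (\<Sum>i=1..n. len j (?I i \<inter> near_diagonal j \<delta>)) + e * (\<Sum>i=1..n. len j (?I i \<inter> {0<..1}))
     + (\<Sum>k\<in>J. B * ((\<Sum>i=1..n. len j (?I i \<inter> near_vine j k \<delta>')) + (\<Sum>i=1..n. len k (?I i \<inter> near_vine j k \<delta>'))))"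
    unfolding step_error_def sum.distrib I[symmetric]
    by (subst sum.swap) (simp only: sum_distrib_left[symmetric] sum.distrib[symmetric])
  also have "\<dots> \<le> step_error B e \<delta> \<delta>' j {0<..1}"
    unfolding step_error_def
    using assms near level_set_subset bound[of j "{0<..1}"]
    by (intro add_mono mult_left_mono sum_mono bound) auto
  finally show ?thesis .
qed

text \<open>A weight may tend to \<open>0\<close> at the diagonal or at infinity. The times at which
  the gap is at least \<open>d\<close> form a compact set, on which the weight attains a minimum,
  positive off the diagonal.\<close>

lemma eventually_weight_ge:
  assumes j: "j \<in> J" and d: "0 < d"
  shows "\<forall>\<^sub>F c in at_right 0. \<forall>x\<in>{0..1}. d \<le> diagonal_gap (V j x) \<longrightarrow> c \<le> w (V j x)"
proof -
  let ?K = "{x \<in> {0..1}. d \<le> diagonal_gap (V j x)}"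
  have cont: "continuous_on {0..1} (V j)"
    using curve[OF j] by (rule rectifiable_curve.cont)
  show ?thesis
  proof (cases "?K = {}")
    case False
    have "closed ?K"
      using continuous_closed_preimage[of "{0..1}" "\<lambda>x. diagonal_gap (V j x)" "{d..}"] cont
      by (auto intro!: continuous_intros simp: vimage_def Int_def)
    then have "compact ?K"
      by (simp add: compact_eq_bounded_closed bounded_subset[of "{0..1}"] subset_eq)
    moreover have "continuous_on ?K (\<lambda>x. w (V j x))"
      by (rule continuous_on_compose2[OF weighting_function_continuous[OF w] continuous_on_subset[OF cont]])
        (use half[OF j] in auto)
    ultimately obtain x where x: "x \<in> ?K" "\<And>y. y \<in> ?K \<Longrightarrow> w (V j x) \<le> w (V j y)"
      using continuous_attains_inf[of ?K "\<lambda>x. w (V j x)"] False by blast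
    have "V j x \<in> half_plane - diagonal"
      using x(1) half[OF j, of x] d diagonal_gap_eq_0_iff[of "V j x"] by auto
    then have "0 < w (V j x)"
      using w by (auto simp: weighting_function_def order_less_le)
    then show ?thesis
      unfolding eventually_at_right_field using x(2) by (intro exI[of _ "w (V j x)"]) force
  next
    case True
    then show ?thesis by (auto intro!: always_eventually)
  qed
qed

text \<open>The order of choices matters: first \<open>B\<close> and \<open>\<rho>\<close>, then
  \<open>\<delta>\<close> and \<open>\<delta>'\<close> from \<open>\<rho>\<close>, then
  \<open>c\<close> from \<open>\<delta>\<close>, then \<open>\<eta>\<close>, then
  \<open>\<omega>\<close>, and last the grid. The level sets are thus fixed before the grid is
  refined, and their measures bound the error summed over all steps.\<close>

lemma eventually_matching_defect_le:
  assumes "0 < \<epsilon>"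
  shows "\<forall>\<^sub>F n in sequentially.
    (\<Sum>i=1..n. \<Sum>j\<in>J. weighted_d w (V j (real i / real n)) (V j ((real i - 1) / real n)))
    \<le> (\<Sum>i=1..n. weighted_wasserstein w (diagram_at (real i / real n)) (diagram_at ((real i - 1) / real n))) + \<epsilon>"
proof -
  have cont: "continuous_on {0..1} (V j)" if "j \<in> J" for j
    using curve[OF that] by (rule rectifiable_curve.cont)
  have "\<forall>j\<in>J. \<exists>B>0. \<forall>t\<in>{0..1}. w (V j t) \<le> B"
    using weighting_function_bounded[OF w cont image_half] by metis
  then obtain b where b: "\<And>j. j \<in> J \<Longrightarrow> 0 < b j" "\<And>j t. j \<in> J \<Longrightarrow> t \<in> {0..1} \<Longrightarrow> w (V j t) \<le> b j"
    by metis
  \<comment> \<open>A common bound for the weights along all vines; the \<open>1\<close> keeps it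
    positive for an empty family.\<close>
  define B where "B = 1 + (\<Sum>j\<in>J. b j)"
  have "b j \<le> (\<Sum>j\<in>J. b j)" if "j \<in> J" for j
    using that b(1) J by (intro member_le_sum) (auto intro: less_imp_le)
  then have wB: "w (V j t) \<le> B" if "j \<in> J" "t \<in> {0..1}" for j t
    using b(2)[OF that] that unfolding B_def by fastforce
  have B: "0 < B"
    unfolding B_def using b(1) by (intro add_pos_nonneg sum_nonneg) (auto intro: less_imp_le)
  \<comment> \<open>The factor of \<open>\<rho>\<close> in the total error once all level sets have
    measure below \<open>\<rho>\<close> and \<open>\<rho>\<close> bounds the change of weight.
    Dividing by \<open>K + 1\<close> below avoids division by \<open>0\<close>.\<close>
  define K where "K = (\<Sum>j\<in>J. B + len j {0<..1} + (\<Sum>k\<in>J. B * 2))"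
  define \<rho> where "\<rho> = \<epsilon> / (K + 1)"
  have K: "0 \<le> K"
    unfolding K_def using B by (intro sum_nonneg add_nonneg_nonneg) auto
  then have \<rho>: "0 < \<rho>" "\<rho> * K \<le> \<epsilon>"
    using assms by (auto simp: \<rho>_def field_simps)
  have "\<forall>\<^sub>F d in at_right 0. \<forall>j\<in>J. len j (near_diagonal j d) < \<rho>"
    using \<rho>(1) by (intro eventually_ball_finite[OF J] ballI rectifiable_curve.measure_level_set_small curve)
      (auto intro!: continuous_intros cont)
  then have "\<forall>\<^sub>F d in at_right 0. 0 < d \<and> (\<forall>j\<in>J. len j (near_diagonal j d) < \<rho>)"
    using eventually_at_right_less by (rule eventually_conj[rotated])
  then obtain \<delta> where \<delta>: "0 < \<delta>" "\<And>j. j \<in> J \<Longrightarrow> len j (near_diagonal j \<delta>) < \<rho>"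
    using eventually_happens'[OF trivial_limit_at_right_real] by blast
  have "\<forall>\<^sub>F d in at_right 0. \<forall>j\<in>J. \<forall>k\<in>J. len j (near_vine j k d) < \<rho> \<and> len k (near_vine j k d) < \<rho>"
    using \<rho>(1) by (intro eventually_ball_finite[OF J] ballI eventually_conj
      rectifiable_curve.measure_level_set_small curve) (auto intro!: continuous_intros cont)
  moreover obtain d0 where d0: "0 < d0"
    "\<And>p q. p \<in> half_plane \<Longrightarrow> q \<in> half_plane \<Longrightarrow> d_inf p q \<le> d0 \<Longrightarrow> \<bar>w p - w q\<bar> < \<rho>"
    using weighting_function_modulus[OF w \<rho>(1)] by blast
  then have "\<forall>\<^sub>F d in at_right 0. 0 < d \<and> d < d0"
    unfolding eventually_at_right_field by blast
  ultimately have "\<forall>\<^sub>F d in at_right 0. (\<forall>j\<in>J. \<forall>k\<in>J. len j (near_vine j k d) < \<rho> \<and> len k (near_vine j k d) < \<rho>)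
      \<and> (0 < d \<and> d < d0)"
    by (rule eventually_conj)
  then obtain \<delta>' where \<delta>': "0 < \<delta>'" "\<delta>' < d0"
    "\<And>j k. j \<in> J \<Longrightarrow> k \<in> J \<Longrightarrow> len j (near_vine j k \<delta>') < \<rho> \<and> len k (near_vine j k \<delta>') < \<rho>"
    using eventually_happens'[OF trivial_limit_at_right_real] by blast
  have modulus: "\<bar>w p - w q\<bar> \<le> \<rho>" if "p \<in> half_plane" "q \<in> half_plane" "d_inf p q \<le> \<delta>'" for p q
    using d0(2)[OF that(1,2)] that(3) \<delta>'(2) by simp
  have "\<forall>\<^sub>F c in at_right 0. \<forall>j\<in>J. \<forall>x\<in>{0..1}. \<delta> / 2 \<le> diagonal_gap (V j x) \<longrightarrow> c \<le> w (V j x)"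
    using \<delta>(1) by (intro eventually_ball_finite[OF J] ballI eventually_weight_ge) auto
  then have "\<forall>\<^sub>F c in at_right 0. 0 < c \<and> (\<forall>j\<in>J. \<forall>x\<in>{0..1}. \<delta> / 2 \<le> diagonal_gap (V j x) \<longrightarrow> c \<le> w (V j x))"
    using eventually_at_right_less by (rule eventually_conj[rotated])
  then obtain c where c: "0 < c"
    "\<And>j x. j \<in> J \<Longrightarrow> x \<in> {0..1} \<Longrightarrow> \<delta> / 2 \<le> diagonal_gap (V j x) \<Longrightarrow> c \<le> w (V j x)"
    using eventually_happens'[OF trivial_limit_at_right_real] by blast
  \<comment> \<open>The first entry is half of \<open>\<delta> * c / 8\<close>, for strictness; the
    second gives \<open>2 * \<eta> / c \<le> \<delta>' / 2\<close> and leaves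
    \<open>\<delta>' / 2\<close> for \<open>3 * \<omega>\<close>.\<close>
  define \<eta> where "\<eta> = min (\<delta> * c / 16) (\<delta>' * c / 4)"
  have \<eta>: "0 < \<eta>" "\<eta> < \<delta> * c / 8" "2 * \<eta> / c \<le> \<delta>' / 2"
  proof -
    show "0 < \<eta>" using \<delta>(1) \<delta>'(1) c(1) by (simp add: \<eta>_def)
    have "\<eta> \<le> \<delta> * c / 16" "0 < \<delta> * c" using \<delta>(1) c(1) by (simp_all add: \<eta>_def)
    then show "\<eta> < \<delta> * c / 8" by linarith
    have "\<eta> \<le> \<delta>' * c / 4" by (simp add: \<eta>_def)
    then show "2 * \<eta> / c \<le> \<delta>' / 2" using c(1) by (simp add: field_simps)
  qed
  \<comment> \<open>The entries ensure \<open>4 * \<omega> \<le> \<delta>\<close>,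
    \<open>3 * \<omega> \<le> \<delta>' / 2\<close>, and that matching along the vines costs at most
    \<open>\<eta>\<close> per step, each vine contributing at most
    \<open>B * \<omega>\<close>.\<close>
  define \<omega> where "\<omega> = Min {\<delta> / 4, \<delta>' / 6, \<eta> / (B * (real (card J) + 1))}"
  have \<omega>: "0 < \<omega>" "\<omega> \<le> \<delta> / 4" "\<omega> \<le> \<delta>' / 6" "\<omega> \<le> \<eta> / (B * (real (card J) + 1))"
  proof -
    show "0 < \<omega>" using \<delta>(1) \<delta>'(1) \<eta>(1) B by (simp add: \<omega>_def)
  qed (unfold \<omega>_def, rule Min_le; simp)+
  have "\<forall>\<^sub>F n in sequentially. \<forall>j\<in>J. \<forall>i\<in>{1..n}. \<forall>s\<in>{(real i - 1) / real n..real i / real n}.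
     \<forall>t\<in>{(real i - 1) / real n..real i / real n}. dist (V j s) (V j t) < \<omega>"
    using \<omega>(1) by (intro eventually_ball_finite[OF J] ballI eventually_grid_close cont) auto
  then show ?thesis
    using eventually_gt_at_top[of 0]
  proof eventually_elim
    case (elim n)
    let ?D = "\<lambda>i j. weighted_d w (V j (real i / real n)) (V j ((real i - 1) / real n))"
    let ?I = "\<lambda>i. {(real i - 1) / real n<..real i / real n}"
    let ?W = "\<lambda>i. weighted_wasserstein w (diagram_at (real i / real n)) (diagram_at ((real i - 1) / real n))"
    have step: "(\<Sum>j\<in>J. ?D i j) \<le> ?W i + (\<Sum>j\<in>J. step_error B \<rho> \<delta> \<delta>' j (?I i))" if i: "i \<in> {1..n}" for i
    proof (rule vine_step[OF grid_in_unit(5,7,4)[OF i]])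
      have osc: "d_inf (V j x) (V j y) \<le> \<omega>" if "j \<in> J" "x \<in> {(real i - 1) / real n..real i / real n}"
        "y \<in> {(real i - 1) / real n..real i / real n}" for j x y
        using elim(1) i that by (intro order_trans[OF d_inf_le_dist] less_imp_le) blast
      then show "\<And>j x y. j \<in> J \<Longrightarrow> x \<in> {(real i - 1) / real n..real i / real n} \<Longrightarrow>
        y \<in> {(real i - 1) / real n..real i / real n} \<Longrightarrow> d_inf (V j x) (V j y) \<le> \<omega>" .
      have "?D i j \<le> B * \<omega>" if "j \<in> J" for j
      proof -
        have "?D i j \<le> B * d_inf (V j (real i / real n)) (V j ((real i - 1) / real n))"
          by (intro weighted_d_le wB that grid_in_unit[OF i])
        also have "\<dots> \<le> B * \<omega>"
          using grid_in_unit(7)[OF i] B by (intro mult_left_mono osc[OF that]) auto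
        finally show ?thesis .
      qed
      then have "(\<Sum>j\<in>J. ?D i j) \<le> real (card J) * (B * \<omega>)"
        by (rule sum_bounded_above)
      also have "\<dots> \<le> B * (real (card J) + 1) * \<omega>"
        using B \<omega>(1) by (simp add: algebra_simps)
      also have "\<dots> \<le> \<eta>"
      proof -
        have "0 < B * (real (card J) + 1)" using B by simp
        from \<omega>(4)[unfolded pos_le_divide_eq[OF this]] show ?thesis
          by (simp only: mult.commute[of \<omega>])
      qed
      finally show "(\<Sum>j\<in>J. ?D i j) \<le> \<eta>" .
    qed (use B wB \<rho> modulus c \<delta> \<eta> \<omega> in auto)
    have "(\<Sum>i=1..n. \<Sum>j\<in>J. step_error B \<rho> \<delta> \<delta>' j (?I i))
        = (\<Sum>j\<in>J. \<Sum>i=1..n. step_error B \<rho> \<delta> \<delta>' j (?I i))"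
      by (rule sum.swap)
    also have "\<dots> \<le> (\<Sum>j\<in>J. step_error B \<rho> \<delta> \<delta>' j {0<..1})"
      using B \<rho> elim(2) by (intro sum_mono sum_step_error_le) auto
    also have "\<dots> \<le> (\<Sum>j\<in>J. \<rho> * (B + len j {0<..1} + (\<Sum>k\<in>J. B * 2)))"
    proof (rule sum_mono)
      fix j assume j: "j \<in> J"
      have "step_error B \<rho> \<delta> \<delta>' j {0<..1}
        = B * len j (near_diagonal j \<delta>) + \<rho> * len j {0<..1}
          + (\<Sum>k\<in>J. B * (len j (near_vine j k \<delta>') + len k (near_vine j k \<delta>')))"
        unfolding step_error_def by (simp only: Int_absorb1[OF level_set_subset])
      also have "\<dots> \<le> B * \<rho> + \<rho> * len j {0<..1} + (\<Sum>k\<in>J. B * (\<rho> + \<rho>))"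
        using B \<delta>(2)[OF j] \<delta>'(3)[OF j]
        by (intro add_mono mult_left_mono sum_mono order_refl) (auto intro: less_imp_le)
      also have "\<dots> = \<rho> * (B + len j {0<..1} + (\<Sum>k\<in>J. B * 2))"
        by (simp add: algebra_simps)
      finally show "step_error B \<rho> \<delta> \<delta>' j {0<..1} \<le> \<rho> * (B + len j {0<..1} + (\<Sum>k\<in>J. B * 2))" .
    qed
    also have "\<dots> = \<rho> * K"
      by (simp add: K_def sum_distrib_left)
    also have "\<dots> \<le> \<epsilon>" by (rule \<rho>(2))
    finally have err: "(\<Sum>i=1..n. \<Sum>j\<in>J. step_error B \<rho> \<delta> \<delta>' j (?I i)) \<le> \<epsilon>" .
    have "(\<Sum>i=1..n. \<Sum>j\<in>J. ?D i j) \<le> (\<Sum>i=1..n. ?W i + (\<Sum>j\<in>J. step_error B \<rho> \<delta> \<delta>' j (?I i)))"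
      by (rule sum_mono) (rule step)
    then show ?case using err by (simp add: sum.distrib)
  qed
qed

text \<open>The sum for the matching along vines tends to the line integrals. It exceeds the
  Wasserstein sum by an amount that is nonnegative and eventually at most any given positive
  bound.\<close>

lemma wasserstein_sum_tendsto:
  "(\<lambda>n. \<Sum>i=1..n. weighted_wasserstein w (diagram_at (real i / real n)) (diagram_at ((real i - 1) / real n)))
    \<longlonglongrightarrow> (\<Sum>j\<in>J. line_integral w (V j))"
proof -
  let ?W = "\<lambda>n. \<Sum>i=1..n. weighted_wasserstein w (diagram_at (real i / real n)) (diagram_at ((real i - 1) / real n))"
  let ?U = "\<lambda>n. \<Sum>i=1..n. \<Sum>j\<in>J. weighted_d w (V j (real i / real n)) (V j ((real i - 1) / real n))"
  have "?U \<longlonglongrightarrow> (\<Sum>j\<in>J. line_integral w (V j))"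
    by (subst sum.swap, intro tendsto_sum weighted_chord_sum_tendsto_line_integral w image_half
        rectifiable_curve.rect[OF curve] rectifiable_curve.cont[OF curve])
  moreover have "(\<lambda>n. ?U n - ?W n) \<longlonglongrightarrow> 0"
  proof (rule tendstoI)
    fix e :: real assume "0 < e"
    then have "\<forall>\<^sub>F n in sequentially. ?U n \<le> ?W n + e / 2"
      by (intro eventually_matching_defect_le) simp
    then show "\<forall>\<^sub>F n in sequentially. dist (?U n - ?W n) 0 < e"
    proof eventually_elim
      case (elim n)
      have "?W n \<le> ?U n"
        by (intro sum_mono weighted_wasserstein_le_indexed J)
      then show ?case using elim \<open>0 < e\<close> by (simp add: dist_real_def)
    qed
  qed
  ultimately show ?thesis
    using tendsto_diff[of ?U _ sequentially "\<lambda>n. ?U n - ?W n" 0] by simp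
qed

end

theorem theorem3:
  fixes \<V> :: "real \<Rightarrow> diagram" and w :: "point \<Rightarrow> real"
    and m :: nat and V :: "nat \<Rightarrow> real \<Rightarrow> point"
  assumes "vineyard \<V>"
    and "weighting_function w"
    and "vine_decomposition \<V> m V"
  shows "(\<lambda>n::nat. \<Sum>i=1..n. weighted_wasserstein w (\<V> (real i / real n)) (\<V> ((real i - 1) / real n)))
           \<longlonglongrightarrow> weighted_vineyard_distance w m V"
proof -
  have \<V>: "\<V> t = image_mset (\<lambda>i. V i t) (mset_set {1..m})" if "t \<in> {0..1}" for t
    using assms(3) that by (simp add: vine_decomposition_def)
  interpret weighted_vines w "{1..m}" V
  proof
    \<comment> \<open>Vines are defined as curves in the plane; that they stay in the half plane
      comes from the vineyard taking its values in \<open>diagrams\<close>.\<close>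
    fix j t assume "j \<in> {1..m}" "t \<in> {0..1::real}"
    then have "V j t \<in># \<V> t" by (simp add: \<V>)
    moreover have "\<V> t \<in> diagrams"
      using continuous_map_image_subset_topspace[OF assms(1)[unfolded vineyard_def]] \<open>t \<in> {0..1}\<close> by auto
    ultimately show "V j t \<in> half_plane" by (auto simp: diagrams_def)
  qed (use assms in \<open>auto simp: vine_decomposition_def\<close>)
  have "(\<Sum>i=1..n. weighted_wasserstein w (\<V> (real i / real n)) (\<V> ((real i - 1) / real n)))
    = (\<Sum>i=1..n. weighted_wasserstein w (diagram_at (real i / real n)) (diagram_at ((real i - 1) / real n)))" for n
    by (intro sum.cong refl arg_cong2[where f = "weighted_wasserstein w"] \<V> grid_in_unit) auto
  then show ?thesis
    using wasserstein_sum_tendsto by (simp add: weighted_vineyard_distance_def)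
qed

end
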